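(* There exists an absolute constant $C>0$ such that the following holds. Let $\mathcal D$ be any distribution on $[0,1]\times\{0,1\}$, let $T\ge2$, and let $S$ be the uniform distribution over $T$ data points $(p_1,y_1),\ldots,(p_T,y_T)$ drawn i.i.d. from $\mathcal D$. For every $\delta\in(e^{-T/2},1/T)$, with probability at least $1-\delta$, $$|\mathsf{SCDL}(S)-\mathsf{SCDL}(\mathcal D)|\le C\sqrt{\frac{\log(1/\delta)}{T}}\,\log\frac{T}{\ln(1/\delta)}.$$ Moreover, if $\mathsf{SCDL}(\mathcal D)=0$, then for every $\delta\in(e^{-T/2},1/T)$, with probability at least $1-\delta$, $$\mathsf{SCDL}(S)\le C\sqrt{\frac{\log(1/\delta)}{T}\,\log\frac{T}{\ln(1/\delta)}}.$$
   Context: For $x\in\mathbb R$ write $x_+=\max\{x,0\}$. Let $\mathcal D$ be a probability distribution of pairs $(p,y)\in[0,1]\times\{0,1\}$. For a positive integer $m$ and $i\in\{0,\ldots,m\}$ let $w_i(p)=(1-|mp-i|)_+$, $\pi_i=\mathbb E_{(p,y)\sim\mathcal D}[w_i(p)]$ and $q_i=\mathbb E_{(p,y)\sim\mathcal D}[w_i(p)y]/\pi_i$ (equivalently: $p$ is randomly rounded to $p'\in\{0,1/m,\ldots,1\}$ with $\Pr[p'=i/m\mid p]=w_i(p)$, so $\mathbb E[p'\mid p]=p$, and $\pi_i=\Pr[p'=i/m]$, $q_i=\mathbb E[y\mid p'=i/m]$; terms with $\pi_i=0$ are taken to be $0$). Define $$\mathsf{SCDL}_m(\mathcal D)=\max_{i=0,\ldots,m}\Big(\sum_{j=0}^{i}\pi_j\big(q_j-\tfrac{i+1}{m}\big)_+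 +\sum_{j=i+1}^{m}\pi_j\big(\tfrac im-q_j\big)_+\Big),$$ and $\mathsf{SCDL}(\mathcal D)=\inf_{m\in\{2^1,2^2,\ldots\}}\max\{\mathsf{SCDL}_m(\mathcal D),1/m\}$. The same definitions apply to the empirical (uniform) distribution $S$. *)

theory Defs
  imports "HOL-Probability.Probability"
begin

text \<open>Labels y in {0,1} are represented by bool (True = 1). A distribution is a
probability measure on real \<times> bool (Borel sets) concentrated on [0,1] \<times> {0,1}.\<close>

definition pos_part :: "real \<Rightarrow> real" where
  "pos_part x = max x 0"

definition rw :: "nat \<Rightarrow> nat \<Rightarrow> real \<Rightarrow> real" where
  "rw m i p = pos_part (1 - \<bar>real m * p - real i\<bar>)"

definition pi_w :: "(real \<times> bool) measure \<Rightarrow> nat \<Rightarrow> nat \<Rightarrow> real" where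
  "pi_w M m i = (\<integral>x. rw m i (fst x) \<partial>M)"

definition q_w :: "(real \<times> bool) measure \<Rightarrow> nat \<Rightarrow> nat \<Rightarrow> real" where
  "q_w M m i = (\<integral>x. rw m i (fst x) * of_bool (snd x) \<partial>M) / pi_w M m i"

definition wterm :: "(real \<times> bool) measure \<Rightarrow> nat \<Rightarrow> nat \<Rightarrow> (real \<Rightarrow> real) \<Rightarrow> real" where
  "wterm M m j g = (if pi_w M m j = 0 then 0 else pi_w M m j * pos_part (g (q_w M m j)))"

definition SCDL_m :: "(real \<times> bool) measure \<Rightarrow> nat \<Rightarrow> real" where
  "SCDL_m M m = Max ((\<lambda>i. (\<Sum>j\<in>{0..i}. wterm M m j (\<lambda>q. q - real (i + 1) / real m))
                         + (\<Sum>j\<in>{i+1..m}. wterm M m j (\<lambda>q. real i / real m - q))) ` {0..m})"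

definition SCDL :: "(real \<times> bool) measure \<Rightarrow> real" where
  "SCDL M = (INF k\<in>{1::nat..}. max (SCDL_m M (2 ^ k)) (1 / 2 ^ k))"

definition empirical :: "(nat \<Rightarrow> real \<times> bool) \<Rightarrow> nat \<Rightarrow> (real \<times> bool) measure" where
  "empirical \<omega> T = measure_pmf (map_pmf \<omega> (pmf_of_set {..<T}))"

end

theory Submission
  imports Defs
begin

text \<open>Write \<open>r = ln (1 / \<delta>) / T\<close>. By Bernstein's inequality and a union bound, all cell masses
\<open>\<pi>\<^sub>j\<close> and label masses \<open>a\<^sub>j = \<pi>\<^sub>j q\<^sub>j\<close> at scales \<open>m \<le> T\<close> deviate by at most
\<open>O(sqrt (\<pi>\<^sub>j r) + r)\<close>; everything else is deterministic. Summing these deviations over the cells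
would only give \<open>sqrt (m r)\<close>. But a cell at distance \<open>k\<close> from the level \<open>i\<close> matters only if \<open>q\<^sub>j\<close> is
at distance of order \<open>k / m\<close> from \<open>j / m\<close>, and then it contributes of order \<open>k \<pi>\<^sub>j / m\<close> to the losses
at the intermediate levels. If these losses are at most \<open>2 / m\<close>, summing them with weights \<open>1 / n\<close> over
the levels at distance \<open>n\<close> from \<open>i\<close> gives \<open>\<Sum> k \<pi>\<^sub>j = O(log m)\<close>, and AM-GM yields the error
\<open>O(sqrt r log m)\<close> for \<open>m \<le> 1 / sqrt r\<close>. The loss increases from scale \<open>m\<close> to \<open>2 m\<close>, because
the hat functions of scale \<open>m\<close> are combinations of those of scale \<open>2 m\<close>; hence only scales with
loss at most \<open>2 / m\<close> are relevant for the infimum. If \<open>SCDL D = 0\<close> then all losses vanish and one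
takes \<open>m\<close> of order \<open>1 / sqrt (r log (1 / r))\<close>. The bounds are symmetric in the distribution and its
sample because the deviations can equally be expressed through the empirical masses.\<close>

subsection \<open>Perturbation of one-sided losses\<close>

text \<open>Stated for arbitrary sequences, so that after a reflection it also serves for the second
  sum of the loss.\<close>

definition over_loss :: "(nat \<Rightarrow> real) \<Rightarrow> (nat \<Rightarrow> real) \<Rightarrow> nat \<Rightarrow> nat \<Rightarrow> real" where
  "over_loss a p m i = (\<Sum>j\<le>i. pos_part (a j - real (i + 1) / real m * p j))"

lemma pos_part_nonneg [simp]: "0 \<le> pos_part x"
  by (simp add: pos_part_def)

lemma pos_part_0 [simp]: "pos_part 0 = 0"
  by (simp add: pos_part_def)

lemma pos_part_ge: "x \<le> pos_part x"
  by (simp add: pos_part_def)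

lemma pos_part_mono: "x \<le> y \<Longrightarrow> pos_part x \<le> pos_part y"
  by (simp add: pos_part_def)

lemma pos_part_mult: "0 \<le> c \<Longrightarrow> pos_part (c * x) = c * pos_part x"
  by (simp add: pos_part_def max_def mult_le_0_iff zero_le_mult_iff)

lemma over_loss_nonneg: "0 \<le> over_loss a p m i"
  by (simp add: over_loss_def sum_nonneg)

lemma harm_le_ln: "1 \<le> n \<Longrightarrow> harm n \<le> 1 + ln (real n)"
proof -
  assume "1 \<le> n"
  then obtain k where "n = Suc k" by (cases n) auto
  moreover have "harm (Suc k) - ln (real (Suc k)) \<le> harm (Suc 0) - ln (real (Suc 0))"
    using decseq_harm_diff_ln by (rule decseqD) simp
  ultimately show ?thesis by (simp add: harm_def)
qed

text \<open>If \<open>a j\<close> exceeds the threshold of level \<open>i\<close> up to a slack \<open>k / (4 m)\<close>, \<open>k = i - j\<close>, then it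
exceeds the thresholds of the levels \<open>i - n\<close> by about \<open>n / m\<close>, so that a small loss at those
levels bounds \<open>p j\<close>.\<close>

lemma weighted_excess_ge:
  fixes a p m i j :: real
  assumes "0 < m" "0 \<le> p" "(i + 1) / m * p - real k / (4 * m) * p \<le> a"
  shows "real k / 4 * p \<le> m * (\<Sum>n=1..k. pos_part (a - (i - real n + 1) / m * p) / real n)"
proof (cases "k = 0")
  case False
  have excess: "(real n - real k / 4) * p / m \<le> pos_part (a - (i - real n + 1) / m * p)" for n
  proof -
    have "(real n - real k / 4) * p / m \<le> a - (i - real n + 1) / m * p"
      using assms by (simp add: field_simps)
    then show ?thesis using pos_part_ge order_trans by blast
  qed
  have "real k * ((real k + 1) / 2 - real k / 4) = (\<Sum>n=1..k. real n - real k / 4)"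
    using double_gauss_sum_from_Suc_0[of k, where 'a = real]
    by (simp add: sum_subtractf algebra_simps)
  then have "real k * ((real k + 1) / 2 - real k / 4) * (p / m)
      = (\<Sum>n=1..k. (real n - real k / 4) * (p / m))"
    by (simp only: sum_distrib_right)
  then have "((real k + 1) / 2 - real k / 4) * (p / m)
      = (\<Sum>n=1..k. (real n - real k / 4) * (p / m)) / real k"
    using False by (simp add: field_simps)
  also have "\<dots> = (\<Sum>n=1..k. (real n - real k / 4) * (p / m) / real k)"
    by (rule sum_divide_distrib)
  \<comment> \<open>\<open>n - k / 4\<close> may be negative, so the positive part is taken first;
    only then is \<open>1 / k\<close> raised to \<open>1 / n\<close>.\<close>
  also have "\<dots> \<le> (\<Sum>n=1..k. pos_part (a - (i - real n + 1) / m * p) / real n)"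
  proof (rule sum_mono)
    fix n assume n: "n \<in> {1..k}"
    have "(real n - real k / 4) * (p / m) / real k
        \<le> pos_part (a - (i - real n + 1) / m * p) / real k"
      using excess[of n] by (intro divide_right_mono) auto
    also have "\<dots> \<le> pos_part (a - (i - real n + 1) / m * p) / real n"
      using n by (intro divide_left_mono) auto
    finally show "(real n - real k / 4) * (p / m) / real k
        \<le> pos_part (a - (i - real n + 1) / m * p) / real n" .
  qed
  finally have "m * (((real k + 1) / 2 - real k / 4) * (p / m))
      \<le> m * (\<Sum>n=1..k. pos_part (a - (i - real n + 1) / m * p) / real n)"
    using assms by (intro mult_left_mono) auto
  moreover have "real k / 4 * p \<le> m * (((real k + 1) / 2 - real k / 4) * (p / m))"
    using assms by (simp add: field_simps)
  ultimately show ?thesis by linarith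
qed simp

lemma sum_triangle_swap:
  fixes f :: "nat \<Rightarrow> nat \<Rightarrow> 'a :: comm_monoid_add"
  shows "(\<Sum>j<i. \<Sum>n=1..i - j. f j n) = (\<Sum>n=1..i. \<Sum>j\<le>i - n. f j n)"
  unfolding sum.Sigma[OF finite_lessThan, OF ballI, OF finite_atLeastAtMost]
    sum.Sigma[OF finite_atLeastAtMost, OF ballI, OF finite_atMost]
  by (rule sum.reindex_bij_witness[where i = "\<lambda>(n, j). (j, n)" and j = "\<lambda>(j, n). (n, j)"]) auto

text \<open>AM-GM splits the error \<open>\<alpha> * sqrt (p j)\<close> of a cell at distance
  \<open>k = i - j\<close> into a part of order \<open>1 / k\<close>, which sums to a harmonic
  number, and a multiple of \<open>k * p j\<close>. The latter is paid by the gap if the cell is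
  well below the threshold, and by the losses at lower levels otherwise. The parameter
  \<open>u\<close> balances the two costs.\<close>

lemma over_loss_perturb:
  assumes m: "0 < m" and p: "\<And>j. j \<le> i \<Longrightarrow> 0 \<le> p j" "\<And>j. j \<le> i \<Longrightarrow> p j \<le> 1"
    and dev: "\<And>j. j \<le> i \<Longrightarrow> A j - real (i + 1) / real m * P j
        \<le> a j - real (i + 1) / real m * p j + \<alpha> * sqrt (p j) + \<beta>"
    and \<alpha>: "0 \<le> \<alpha>" and \<beta>: "0 \<le> \<beta>" and u: "0 < u" "u \<le> 1 / real m"
    and B: "\<And>i'. i' \<le> i \<Longrightarrow> over_loss a p m i' \<le> B"
  shows "over_loss A P m i \<le> over_loss a p m i
    + (\<alpha> + real (i + 1) * \<beta> + \<alpha>\<^sup>2 / u * harm i + u * real m * B * harm i)"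
proof -
  define c where "c = real (i + 1) / real m"
  define G where "G j = real m * (\<Sum>n=1..i - j. pos_part (a j - (real i - real n + 1) / real m * p j) / real n)" for j
  have G0: "0 \<le> G j" for j unfolding G_def by (intro mult_nonneg_nonneg sum_nonneg) auto
  have amgm: "\<alpha> * sqrt x \<le> b * x + \<alpha>\<^sup>2 / (4 * b)" if "0 \<le> x" "0 < b" for x b
  proof -
    have "0 \<le> (2 * b * sqrt x - \<alpha>)\<^sup>2 / (4 * b)" using that by simp
    also have "\<dots> = b * (sqrt x)\<^sup>2 + \<alpha>\<^sup>2 / (4 * b) - \<alpha> * sqrt x"
      using that by (simp add: power2_eq_square field_simps)
    finally show ?thesis using that by simp
  qed
  have step: "pos_part (A j - c * P j)
      \<le> pos_part (a j - c * p j) + (\<beta> + \<alpha>\<^sup>2 / u / real (i - j) + u * G j)" if j: "j < i" for j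
  proof -
    define k where "k = i - j"
    have k: "0 < k" using j by (simp add: k_def)
    have pj: "0 \<le> p j" using p j by simp
    have d: "A j - c * P j \<le> a j - c * p j + \<alpha> * sqrt (p j) + \<beta>"
      using dev[of j] j by (simp add: c_def)
    have "\<alpha> * sqrt (p j) \<le> pos_part (a j - c * p j) - (a j - c * p j) + \<alpha>\<^sup>2 / u / real k + u * G j"
    proof (cases "c * p j - real k / (4 * real m) * p j \<le> a j")
      case True
      \<comment> \<open>AM-GM is used with weight \<open>u * k / 4\<close>: its linear part is
        \<open>u\<close> times the quantity that \<open>weighted_excess_ge\<close> bounds by
        \<open>G j\<close>.\<close>
      have "real k / 4 * p j \<le> G j"
        unfolding G_def k_def[symmetric]
        by (rule weighted_excess_ge) (use True m pj in \<open>auto simp: c_def add.commute\<close>)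
      then have "u * (real k / 4 * p j) \<le> u * G j" using u by (intro mult_left_mono) auto
      moreover have "\<alpha> * sqrt (p j) \<le> (u * real k / 4) * p j + \<alpha>\<^sup>2 / (4 * (u * real k / 4))"
        using u k pj by (intro amgm) auto
      moreover have "\<alpha>\<^sup>2 / (4 * (u * real k / 4)) = \<alpha>\<^sup>2 / u / real k" by simp
      ultimately show ?thesis using pos_part_ge[of "a j - c * p j"] by (simp add: mult.assoc)
    next
      case False
      \<comment> \<open>The cell is below the threshold by more than
        \<open>k / (4 * m) * p j\<close>. This weight lets the gap absorb the linear part; the
        remaining \<open>\<alpha>^2 * m / k\<close> is controlled by
        \<open>u \<le> 1 / m\<close>.\<close>
      have "\<alpha> * sqrt (p j) \<le> (real k / (4 * real m)) * p j + \<alpha>\<^sup>2 / (4 * (real k / (4 * real m)))"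
        using m k pj by (intro amgm) auto
      moreover have "\<alpha>\<^sup>2 / (4 * (real k / (4 * real m))) \<le> \<alpha>\<^sup>2 / u / real k"
      proof -
        have "\<alpha>\<^sup>2 * real m \<le> \<alpha>\<^sup>2 * (1 / u)"
          using u m by (intro mult_left_mono) (auto simp: field_simps)
        then show ?thesis using k by (simp add: divide_right_mono flip: divide_divide_eq_left)
      qed
      moreover have "0 \<le> u * G j" using u G0 by simp
      ultimately show ?thesis using False pos_part_nonneg[of "a j - c * p j"] by linarith
    qed
    moreover have "0 \<le> \<alpha>\<^sup>2 / u / real k" "0 \<le> u * G j" using u G0 by auto
    ultimately show ?thesis using d \<beta> unfolding k_def pos_part_def by auto
  qed
  \<comment> \<open>At distance 0 there is nothing to trade against; the error is bounded through
    \<open>p i \<le> 1\<close>.\<close>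
  have last: "pos_part (A i - c * P i) \<le> pos_part (a i - c * p i) + (\<alpha> + \<beta>)"
  proof -
    have "\<alpha> * sqrt (p i) \<le> \<alpha> * 1" using p \<alpha> by (intro mult_left_mono) auto
    then show ?thesis using dev[of i] \<alpha> \<beta> unfolding c_def pos_part_def by auto
  qed
  have harm': "harm i = (\<Sum>j<i. 1 / real (i - j))"
    unfolding harm_def
    by (rule sum.reindex_bij_witness[where i = "\<lambda>j. i - j" and j = "\<lambda>j. i - j"])
       (auto simp: inverse_eq_divide)
  \<comment> \<open>For fixed \<open>n\<close>, the summands over the cells
    \<open>j \<le> i - n\<close> are exactly those of the loss at level
    \<open>i - n\<close>.\<close>
  have "(\<Sum>j<i. G j) = real m * (\<Sum>n=1..i. over_loss a p m (i - n) / real n)"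
    unfolding G_def sum_distrib_left[symmetric] sum_triangle_swap over_loss_def sum_divide_distrib
    by (simp add: of_nat_diff add.commute diff_add_eq)
  also have "\<dots> \<le> real m * (\<Sum>n=1..i. B * inverse (real n))"
    using B by (intro mult_left_mono sum_mono) (auto simp: divide_inverse intro!: mult_right_mono)
  also have "\<dots> = real m * B * harm i"
    by (simp add: harm_def sum_distrib_left mult.assoc)
  finally have sumG: "u * (\<Sum>j<i. G j) \<le> u * (real m * B * harm i)"
    using u by (intro mult_left_mono) auto
  have split: "(\<Sum>j\<le>i. f j) = (\<Sum>j<i. f j) + f i" for f :: "nat \<Rightarrow> real"
    by (simp flip: lessThan_Suc_atMost)
  have "over_loss A P m i = (\<Sum>j<i. pos_part (A j - c * P j)) + pos_part (A i - c * P i)"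
    unfolding over_loss_def c_def by (rule split)
  also have "\<dots> \<le> (\<Sum>j<i. pos_part (a j - c * p j) + (\<beta> + \<alpha>\<^sup>2 / u / real (i - j) + u * G j))
      + (pos_part (a i - c * p i) + (\<alpha> + \<beta>))"
    by (intro add_mono sum_mono step last) auto
  also have "\<dots> = over_loss a p m i + (\<alpha> + real (i + 1) * \<beta> + \<alpha>\<^sup>2 / u * harm i + u * (\<Sum>j<i. G j))"
    unfolding over_loss_def c_def[symmetric] split harm'
    by (simp add: sum.distrib sum_distrib_left algebra_simps)
  finally show ?thesis using sumG by (simp add: mult.assoc)
qed

section \<open>Doubling the scale\<close>

text \<open>The middle term is the odd neighbour to the left, absent for \<open>j = 0\<close>.\<close>

definition refines :: "nat \<Rightarrow> (nat \<Rightarrow> real) \<Rightarrow> (nat \<Rightarrow> real) \<Rightarrow> bool" where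
  "refines m a a' \<longleftrightarrow> (\<forall>j<m. a j = a' (2 * j) + (if j = 0 then 0 else a' (2 * j - 1)) / 2 + a' (2 * j + 1) / 2)"

lemma refinesD: "refines m a a' \<Longrightarrow> j < m \<Longrightarrow>
    a j = a' (2 * j) + (if j = 0 then 0 else a' (2 * j - 1)) / 2 + a' (2 * j + 1) / 2"
  by (simp add: refines_def)

text \<open>The positive part is subadditive, so splitting each coarse cell into fine cells can only
  increase the loss. The coarse level \<open>i\<close> corresponds to the average of its two fine
  levels.\<close>

lemma over_loss_refine:
  assumes "refines m a a'" "refines m p p'" "i < m" and p': "\<And>j. 0 \<le> p' j"
  shows "over_loss a p m i \<le> (over_loss a' p' (2 * m) (2 * i) + over_loss a' p' (2 * m) (2 * i + 1)) / 2"
proof -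
  define c where "c = real (i + 1) / real m"
  define f where "f l = pos_part (a' l - c * p' l)" for l
  define g where "g j = f (2 * j) + (if j = 0 then 0 else f (2 * j - 1)) / 2 + f (2 * j + 1) / 2" for j
  have half: "pos_part (x + y / 2 + z / 2) \<le> pos_part x + pos_part y / 2 + pos_part z / 2" for x y z
    by (auto simp: pos_part_def max_def)
  have "over_loss a p m i \<le> (\<Sum>j\<le>i. g j)"
    unfolding over_loss_def c_def[symmetric]
  proof (rule sum_mono)
    fix j assume "j \<in> {..i}"
    then have "j < m" using assms by auto
    then have "a j - c * p j = (a' (2 * j) - c * p' (2 * j))
       + (if j = 0 then 0 else a' (2 * j - 1) - c * p' (2 * j - 1)) / 2 + (a' (2 * j + 1) - c * p' (2 * j + 1)) / 2"
      unfolding refinesD[OF assms(1) \<open>j < m\<close>] refinesD[OF assms(2) \<open>j < m\<close>]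
      by (simp add: algebra_simps diff_divide_distrib)
    then show "pos_part (a j - c * p j) \<le> g j"
      using half[of "a' (2 * j) - c * p' (2 * j)"
          "if j = 0 then 0 else a' (2 * j - 1) - c * p' (2 * j - 1)"
          "a' (2 * j + 1) - c * p' (2 * j + 1)"]
      unfolding g_def f_def by (simp split: if_split_asm)
  qed
  \<comment> \<open>Even cells count once. Odd cells below \<open>2 * i\<close> receive one half
    from each neighbour, and the last one, \<open>2 * i + 1\<close>, receives a single half.\<close>
  also have "\<dots> = ((\<Sum>l\<le>2 * i. f l) + (\<Sum>l\<le>2 * i + 1. f l)) / 2"
    by (induction i) (auto simp: g_def numeral_2_eq_2)
  also have "\<dots> \<le> (over_loss a' p' (2 * m) (2 * i) + over_loss a' p' (2 * m) (2 * i + 1)) / 2"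
  proof -
    \<comment> \<open>The fine thresholds \<open>(2 * i + 1) / (2 * m)\<close> and
      \<open>(2 * i + 2) / (2 * m)\<close> do not exceed \<open>(i + 1) / m\<close>, and lowering a
      threshold raises the loss.\<close>
    have "(\<Sum>l\<le>2 * i. f l) \<le> over_loss a' p' (2 * m) (2 * i)"
      unfolding over_loss_def f_def c_def
      by (intro sum_mono pos_part_mono diff_left_mono mult_right_mono p')
         (use assms in \<open>auto simp: field_simps\<close>)
    moreover have "(\<Sum>l\<le>2 * i + 1. f l) \<le> over_loss a' p' (2 * m) (2 * i + 1)"
      unfolding over_loss_def f_def c_def
      by (intro sum_mono pos_part_mono diff_left_mono mult_right_mono p')
         (use assms in \<open>auto simp: field_simps\<close>)
    ultimately show ?thesis by simp
  qed
  finally show ?thesis .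
qed

text \<open>\<open>refines\<close> leaves out the last cell, which lacks a right neighbour.
  Reflection turns it into cell 0, so its relation is supplied separately.\<close>

lemma refines_reflect:
  assumes "refines m a a'" "a m = a' (2 * m) + a' (2 * m - 1) / 2"
  shows "refines m (\<lambda>j. a (m - j)) (\<lambda>j. a' (2 * m - j))"
  unfolding refines_def
proof safe
  fix j assume j: "j < m"
  show "a (m - j) = a' (2 * m - 2 * j) + (if j = 0 then 0 else a' (2 * m - (2 * j - 1))) / 2 + a' (2 * m - (2 * j + 1)) / 2"
  proof (cases "j = 0")
    case False
    then have "m - j < m" "m - j \<noteq> 0" "2 * (m - j) = 2 * m - 2 * j" "2 * (m - j) + 1 = 2 * m - (2 * j - 1)"
       "2 * (m - j) - 1 = 2 * m - (2 * j + 1)"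
      using j by auto
    then show ?thesis using assms(1) False unfolding refines_def by simp
  qed (use assms in simp)
qed

lemma refines_diff: "refines m a a' \<Longrightarrow> refines m b b' \<Longrightarrow> refines m (\<lambda>j. a j - b j) (\<lambda>j. a' j - b' j)"
  by (simp add: refines_def diff_divide_distrib)

subsection \<open>Losses of a forecast\<close>

text \<open>This is \<pi>_j q_j; the unnormalised mass avoids the division by a possibly vanishing
  \<open>pi_w\<close>.\<close>

definition a_w :: "(real \<times> bool) measure \<Rightarrow> nat \<Rightarrow> nat \<Rightarrow> real" where
  "a_w M m j = (\<integral>x. rw m j (fst x) * of_bool (snd x) \<partial>M)"

text \<open>Exchanging the labels and replacing the forecast p by 1 - p sends cell \<open>j\<close>
  to \<open>m - j\<close> and level \<open>i\<close> to \<open>m - 1 - i\<close>, whose threshold is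
  \<open>1 - i / m\<close>. This turns underestimates into overestimates.\<close>

definition under_loss :: "(nat \<Rightarrow> real) \<Rightarrow> (nat \<Rightarrow> real) \<Rightarrow> nat \<Rightarrow> nat \<Rightarrow> real" where
  "under_loss a p m i = over_loss (\<lambda>j. p (m - j) - a (m - j)) (\<lambda>j. p (m - j)) m (m - 1 - i)"

definition level_loss :: "(real \<times> bool) measure \<Rightarrow> nat \<Rightarrow> nat \<Rightarrow> real" where
  "level_loss M m i = over_loss (a_w M m) (pi_w M m) m i + under_loss (a_w M m) (pi_w M m) m i"

lemma under_loss_nonneg: "0 \<le> under_loss a p m i"
  by (simp add: under_loss_def over_loss_nonneg)

lemma under_loss_altdef:
  assumes "i < m"
  shows "under_loss a p m i = (\<Sum>j\<in>{i+1..m}. pos_part (real i / real m * p j - a j))"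
  unfolding under_loss_def over_loss_def
  by (rule sum.reindex_bij_witness[where i = "\<lambda>j. m - j" and j = "\<lambda>j. m - j"])
     (use assms in \<open>auto simp: of_nat_diff field_simps intro!: arg_cong[of _ _ pos_part]\<close>)

section \<open>Hat functions and their two-scale relation\<close>

lemma rw_nonneg: "0 \<le> rw m j p" and rw_le_1: "rw m j p \<le> 1"
  by (auto simp: rw_def pos_part_def)

lemma rw_measurable [measurable]: "rw m j \<in> borel_measurable borel"
  unfolding rw_def[abs_def] pos_part_def by measurable

text \<open>A hat function is the sum of the half-width hat at its centre and half of each of the
  two adjacent ones. The hats centred outside the unit interval, at the ends \<open>j = 0\<close>
  and \<open>j = m\<close>, vanish on it.\<close>

lemma rw_refine:
  assumes "0 \<le> p" "p \<le> 1" "j \<le> m"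
  shows "rw m j p = rw (2 * m) (2 * j) p + (if j = 0 then 0 else rw (2 * m) (2 * j - 1) p) / 2
     + (if j = m then 0 else rw (2 * m) (2 * j + 1) p) / 2"
proof -
  define h where "h x = pos_part (1 - \<bar>x\<bar>)" for x
  have h: "h x = h (2 * x) + h (2 * x + 1) / 2 + h (2 * x - 1) / 2" for x
    unfolding h_def pos_part_def max_def abs_if by auto
  have r: "rw n k p = h (real n * p - real k)" for n k by (simp add: rw_def h_def)
  have l: "(if j = 0 then 0 else rw (2 * m) (2 * j - 1) p) = h (2 * (real m * p - real j) + 1)"
  proof (cases "j = 0")
    case True
    then show ?thesis using assms by (simp add: h_def pos_part_def)
  qed (simp add: r of_nat_diff algebra_simps)
  have "(if j = m then 0 else rw (2 * m) (2 * j + 1) p) = h (2 * (real m * p - real j) - 1)"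
  proof (cases "j = m")
    case True
    then show ?thesis using assms mult_left_mono[of p 1 "real m"] by (simp add: h_def pos_part_def)
  qed (simp add: r algebra_simps)
  with l h[of "real m * p - real j"] show ?thesis
    by (simp only: r) (simp add: algebra_simps)
qed

text \<open>Only measurability of the coordinates is required, since the true distribution lives on
  the Borel sets and the empirical one on all subsets.\<close>

locale forecast = prob_space M for M :: "(real \<times> bool) measure" +
  assumes fst_measurable [measurable]: "fst \<in> borel_measurable M"
    and snd_measurable [measurable]: "Measurable.pred M snd"
    and range: "AE x in M. fst x \<in> {0..1}"
begin

lemma rw_integrable: "integrable M (\<lambda>x. rw m j (fst x))"
  by (rule integrable_const_bound[where B = 1])
     (auto simp: rw_nonneg rw_le_1)

lemma rw_label_integrable: "integrable M (\<lambda>x. rw m j (fst x) * of_bool (snd x))"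
  by (rule integrable_const_bound[where B = 1])
     (auto simp: rw_nonneg rw_le_1)

lemma a_w_nonneg: "0 \<le> a_w M m j"
  unfolding a_w_def by (simp add: rw_nonneg)

lemma pi_w_nonneg: "0 \<le> pi_w M m j"
  unfolding pi_w_def by (simp add: rw_nonneg)

lemma a_w_le_pi_w: "a_w M m j \<le> pi_w M m j"
  unfolding a_w_def pi_w_def
  by (intro integral_mono rw_integrable rw_label_integrable) (simp add: rw_nonneg)

lemma pi_w_le_1: "pi_w M m j \<le> 1"
proof -
  have "pi_w M m j \<le> (\<integral>x. 1 \<partial>M)"
    unfolding pi_w_def by (intro integral_mono rw_integrable) (simp_all add: rw_le_1)
  then show ?thesis by (simp add: prob_space)
qed

lemma integral_cong_range:
  fixes f g :: "real \<times> bool \<Rightarrow> real"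
  assumes "f \<in> borel_measurable M" "g \<in> borel_measurable M"
    and "\<And>x. 0 \<le> fst x \<Longrightarrow> fst x \<le> 1 \<Longrightarrow> f x = g x"
  shows "integral\<^sup>L M f = integral\<^sup>L M g"
  by (rule integral_cong_AE[OF assms(1,2)]) (use range in eventually_elim, auto intro: assms(3))

lemma pi_w_refine:
  assumes "j \<le> m"
  shows "pi_w M m j = pi_w M (2 * m) (2 * j) + (if j = 0 then 0 else pi_w M (2 * m) (2 * j - 1)) / 2
     + (if j = m then 0 else pi_w M (2 * m) (2 * j + 1)) / 2"
proof -
  have "pi_w M m j = (\<integral>x. rw (2 * m) (2 * j) (fst x) + (if j = 0 then 0 else rw (2 * m) (2 * j - 1) (fst x)) / 2
     + (if j = m then 0 else rw (2 * m) (2 * j + 1) (fst x)) / 2 \<partial>M)"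
    unfolding pi_w_def
    using rw_refine[OF _ _ assms] by (intro integral_cong_range) auto
  then show ?thesis by (auto simp: pi_w_def rw_integrable)
qed

lemma a_w_refine:
  assumes "j \<le> m"
  shows "a_w M m j = a_w M (2 * m) (2 * j) + (if j = 0 then 0 else a_w M (2 * m) (2 * j - 1)) / 2
     + (if j = m then 0 else a_w M (2 * m) (2 * j + 1)) / 2"
proof -
  have "a_w M m j = (\<integral>x. rw (2 * m) (2 * j) (fst x) * of_bool (snd x)
     + (if j = 0 then 0 else rw (2 * m) (2 * j - 1) (fst x) * of_bool (snd x)) / 2
     + (if j = m then 0 else rw (2 * m) (2 * j + 1) (fst x) * of_bool (snd x)) / 2 \<partial>M)"
    unfolding a_w_def
    using rw_refine[OF _ _ assms] by (intro integral_cong_range) (auto simp: algebra_simps)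
  then show ?thesis by (auto simp: a_w_def rw_label_integrable)
qed

lemma level_loss_refine:
  assumes "i < m"
  shows "level_loss M m i \<le> (level_loss M (2 * m) (2 * i) + level_loss M (2 * m) (2 * i + 1)) / 2"
proof -
  have r: "refines m (a_w M m) (a_w M (2 * m))" "refines m (pi_w M m) (pi_w M (2 * m))"
    using a_w_refine[of _ m] pi_w_refine[of _ m] by (simp_all add: refines_def)
  have r': "refines m (\<lambda>j. a_w M m (m - j)) (\<lambda>j. a_w M (2 * m) (2 * m - j))"
    "refines m (\<lambda>j. pi_w M m (m - j)) (\<lambda>j. pi_w M (2 * m) (2 * m - j))"
    using assms a_w_refine[of m m] pi_w_refine[of m m] by (auto intro!: refines_reflect r)
  \<comment> \<open>Reflection interchanges the two fine levels belonging to
    \<open>i\<close>.\<close>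
  have "2 * (m - 1 - i) = 2 * m - 1 - (2 * i + 1)" "2 * (m - 1 - i) + 1 = 2 * m - 1 - 2 * i"
    using assms by auto
  then have "under_loss (a_w M m) (pi_w M m) m i \<le> (under_loss (a_w M (2 * m)) (pi_w M (2 * m)) (2 * m) (2 * i)
     + under_loss (a_w M (2 * m)) (pi_w M (2 * m)) (2 * m) (2 * i + 1)) / 2"
    unfolding under_loss_def using assms
      over_loss_refine[OF refines_diff[OF r'(2) r'(1)] r'(2), of "m - 1 - i"] pi_w_nonneg
    by simp
  then show ?thesis
    unfolding level_loss_def using over_loss_refine[OF r assms] pi_w_nonneg by simp
qed

text \<open>Multiplying by \<open>pi_w\<close> clears the denominator. The convention for empty
  cells is consistent because \<open>0 \<le> a_w \<le> pi_w\<close> forces the label mass to vanish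
  as well.\<close>

lemma wterm_over: "wterm M m j (\<lambda>q. q - c) = pos_part (a_w M m j - c * pi_w M m j)"
  and wterm_under: "wterm M m j (\<lambda>q. c - q) = pos_part (c * pi_w M m j - a_w M m j)"
proof -
  have "a_w M m j = 0" if "pi_w M m j = 0"
    using a_w_nonneg[of m j] a_w_le_pi_w[of m j] that by simp
  moreover have "q_w M m j = a_w M m j / pi_w M m j" by (simp add: q_w_def a_w_def)
  ultimately show "wterm M m j (\<lambda>q. q - c) = pos_part (a_w M m j - c * pi_w M m j)"
    "wterm M m j (\<lambda>q. c - q) = pos_part (c * pi_w M m j - a_w M m j)"
    using pi_w_nonneg[of m j]
    by (auto simp: wterm_def algebra_simps simp flip: pos_part_mult)
qed

lemma SCDL_m_altdef:
  assumes "0 < m"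
  shows "SCDL_m M m = Max (insert 0 (level_loss M m ` {..<m}))"
proof -
  define g where "g i = (\<Sum>j\<in>{0..i}. wterm M m j (\<lambda>q. q - real (i + 1) / real m))
                         + (\<Sum>j\<in>{i+1..m}. wterm M m j (\<lambda>q. real i / real m - q))" for i
  have "g i = level_loss M m i" if "i < m" for i
    using that unfolding g_def wterm_over wterm_under level_loss_def over_loss_def
    by (simp add: under_loss_altdef atLeast0AtMost)
  \<comment> \<open>At level \<open>m\<close> the threshold exceeds 1 and the second sum is empty;
    the inserted 0 stands for this level.\<close>
  moreover have "g m = 0"
  proof -
    have "pos_part (a_w M m j - real (m + 1) / real m * pi_w M m j) = 0" for j
    proof -
      have "1 * pi_w M m j \<le> real (m + 1) / real m * pi_w M m j"
        using assms by (intro mult_right_mono pi_w_nonneg) simp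
      then show ?thesis using a_w_le_pi_w[of m j] by (simp add: pos_part_def)
    qed
    then show ?thesis by (simp add: g_def wterm_over)
  qed
  moreover have "{0..m} = insert m {..<m}" by auto
  ultimately have "g ` {0..m} = insert 0 (level_loss M m ` {..<m})" by auto
  moreover have "SCDL_m M m = Max (g ` {0..m})" by (simp add: SCDL_m_def g_def[abs_def])
  ultimately show ?thesis by simp
qed

lemma level_loss_le_SCDL_m: "i < m \<Longrightarrow> level_loss M m i \<le> SCDL_m M m"
  by (simp add: SCDL_m_altdef)

lemma SCDL_m_nonneg: "0 < m \<Longrightarrow> 0 \<le> SCDL_m M m"
  by (simp add: SCDL_m_altdef)

lemma SCDL_m_le:
  "0 < m \<Longrightarrow> 0 \<le> b \<Longrightarrow> (\<And>i. i < m \<Longrightarrow> level_loss M m i \<le> b) \<Longrightarrow> SCDL_m M m \<le> b"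
  by (auto simp: SCDL_m_altdef)

lemma SCDL_m_double:
  assumes "0 < m"
  shows "SCDL_m M m \<le> SCDL_m M (2 * m)"
proof (rule SCDL_m_le)
  fix i assume "i < m"
  then show "level_loss M m i \<le> SCDL_m M (2 * m)"
    using level_loss_refine[of i m] level_loss_le_SCDL_m[of "2 * i" "2 * m"]
      level_loss_le_SCDL_m[of "2 * i + 1" "2 * m"] by simp
qed (use assms SCDL_m_nonneg in auto)

lemma SCDL_m_pow2_mono: "k \<le> l \<Longrightarrow> SCDL_m M (2 ^ k) \<le> SCDL_m M (2 ^ l)"
  by (rule lift_Suc_mono_le[where f = "\<lambda>k. SCDL_m M (2 ^ k)"]) (use SCDL_m_double in auto)

text \<open>Each cell enters exactly one of the two sums, with at most its mass. This gives the a
  priori bound on \<open>SCDL\<close> and makes the coarsest scale always relevant in the sense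
  \<open>SCDL_m \<le> 2 / m\<close>.\<close>

lemma SCDL_2_le_1: "SCDL_m M 2 \<le> 1"
proof (rule SCDL_m_le)
  fix i :: nat assume i: "i < 2"
  define f where "f j = pi_w M 2 j" for j
  have ov: "pos_part (a_w M 2 j - c * pi_w M 2 j) \<le> f j" if "0 \<le> c" for c j
    using a_w_le_pi_w[of 2 j] pi_w_nonneg[of 2 j] mult_nonneg_nonneg[OF that pi_w_nonneg[of 2 j]]
    by (simp add: pos_part_def f_def)
  have un: "pos_part (c * pi_w M 2 j - a_w M 2 j) \<le> f j" if "c \<le> 1" for c j
    using a_w_nonneg[of 2 j] pi_w_nonneg[of 2 j] mult_right_mono[OF that pi_w_nonneg[of 2 j]]
    by (simp add: pos_part_def f_def)
  have "level_loss M 2 i \<le> (\<Sum>j\<le>i. f j) + (\<Sum>j\<in>{i+1..2}. f j)"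
    unfolding level_loss_def under_loss_altdef[OF i] unfolding over_loss_def
    using i by (intro add_mono sum_mono ov un) auto
  also have "\<dots> = f 0 + f 1 + f 2"
  proof -
    have "i = 0 \<or> i = 1" using i by auto
    then show ?thesis by (auto simp: numeral_2_eq_2)
  qed
  also have "\<dots> = (\<integral>x. rw 2 0 (fst x) + rw 2 1 (fst x) + rw 2 2 (fst x) \<partial>M)"
    by (simp add: f_def pi_w_def rw_integrable)
  \<comment> \<open>The three hat functions form a partition of unity on the unit interval.\<close>
  also have "\<dots> = (\<integral>x. 1 \<partial>M)"
    by (intro integral_cong_range)
       (auto simp: rw_def pos_part_def max_def abs_if)
  finally show "level_loss M 2 i \<le> 1" by (simp add: prob_space)
qed auto

end

section \<open>Stability at a fixed scale\<close>

text \<open>Both deviations are measured by the cell masses of the first measure. The constants are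
  larger than those of the tail bound, so that the relation can be obtained in both
  directions.\<close>

definition close :: "real \<Rightarrow> (real \<times> bool) measure \<Rightarrow> (real \<times> bool) measure \<Rightarrow> nat \<Rightarrow> bool" where
  "close \<rho> M N m \<longleftrightarrow> (\<forall>j\<le>m. \<bar>pi_w N m j - pi_w M m j\<bar> \<le> 3 * sqrt (pi_w M m j * \<rho>) + 6 * \<rho> \<and>
      \<bar>a_w N m j - a_w M m j\<bar> \<le> 3 * sqrt (pi_w M m j * \<rho>) + 6 * \<rho>)"

lemma SCDL_m_perturb:
  assumes M: "forecast M" and N: "forecast N" and close: "close \<rho> M N m" and m: "0 < m"
    and \<rho>: "0 \<le> \<rho>" and u: "0 < u" "u \<le> 1 / real m" and B: "SCDL_m M m \<le> B"
  shows "SCDL_m N m \<le> SCDL_m M m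
    + 2 * (6 * sqrt \<rho> + 12 * real m * \<rho> + (36 * \<rho> / u + u * real m * B) * harm m)"
proof -
  interpret M: forecast M by fact
  interpret N: forecast N by fact
  \<comment> \<open>The error of \<open>over_loss_perturb\<close> with
    \<open>\<alpha> = 6 * sqrt \<rho>\<close> and \<open>\<beta> = 12 * \<rho>\<close>: the
    deviations of \<open>a_w\<close> and \<open>pi_w\<close> add up, the threshold being at most 1.
    The final factor 2 accounts for the two one-sided losses.\<close>
  define E where "E i = 6 * sqrt \<rho> + real (i + 1) * (12 * \<rho>) + (6 * sqrt \<rho>)\<^sup>2 / u * harm i
    + u * real m * B * harm i" for i :: nat
  define E' where "E' = 6 * sqrt \<rho> + 12 * real m * \<rho> + (36 * \<rho> / u + u * real m * B) * harm m"
  have B0: "0 \<le> B" using B M.SCDL_m_nonneg[OF m] by simp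
  have E: "E i \<le> E'" if "i < m" for i
  proof -
    have "real (i + 1) * (12 * \<rho>) \<le> real m * (12 * \<rho>)"
      using that \<rho> by (intro mult_right_mono) auto
    moreover have "(36 * \<rho> / u + u * real m * B) * harm i \<le> (36 * \<rho> / u + u * real m * B) * harm m"
      using that \<rho> u B0 by (intro mult_left_mono harm_mono) auto
    ultimately show ?thesis using \<rho> by (simp add: E_def E'_def power_mult_distrib algebra_simps)
  qed
  have E'0: "0 \<le> E'" unfolding E'_def using \<rho> u B0 harm_nonneg[of m, where 'a = real]
    by (intro add_nonneg_nonneg mult_nonneg_nonneg) auto
  have cM: "over_loss (a_w M m) (pi_w M m) m i \<le> B \<and> under_loss (a_w M m) (pi_w M m) m i \<le> B"
    if "i < m" for i
    using M.level_loss_le_SCDL_m[OF that] B over_loss_nonneg[of "a_w M m" "pi_w M m" m i]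
      under_loss_nonneg[of "a_w M m" "pi_w M m" m i]
    by (simp add: level_loss_def)
  have dev: "x - c * y \<le> 6 * sqrt \<rho> * sqrt (pi_w M m j) + 12 * \<rho>"
    if "0 \<le> c" "c \<le> 1" "\<bar>x\<bar> \<le> 3 * sqrt (pi_w M m j * \<rho>) + 6 * \<rho>"
      "\<bar>y\<bar> \<le> 3 * sqrt (pi_w M m j * \<rho>) + 6 * \<rho>" for c x y j
  proof -
    have "\<bar>c * y\<bar> \<le> 1 * (3 * sqrt (pi_w M m j * \<rho>) + 6 * \<rho>)"
      unfolding abs_mult using that by (intro mult_mono) auto
    then show ?thesis using that by (simp add: real_sqrt_mult algebra_simps abs_le_iff)
  qed
  have cl: "\<bar>pi_w N m j - pi_w M m j\<bar> \<le> 3 * sqrt (pi_w M m j * \<rho>) + 6 * \<rho>"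
    "\<bar>a_w N m j - a_w M m j\<bar> \<le> 3 * sqrt (pi_w M m j * \<rho>) + 6 * \<rho>" if "j \<le> m" for j
    using close that by (auto simp: close_def)
  have over: "over_loss (a_w N m) (pi_w N m) m i \<le> over_loss (a_w M m) (pi_w M m) m i + E'"
    if i: "i < m" for i
  proof -
    have "over_loss (a_w N m) (pi_w N m) m i \<le> over_loss (a_w M m) (pi_w M m) m i + E i"
      unfolding E_def
    proof (rule over_loss_perturb[OF m])
      fix j assume "j \<le> i"
      have c: "0 \<le> real (i + 1) / real m" "real (i + 1) / real m \<le> 1" using i by auto
      have "(a_w N m j - a_w M m j) - real (i + 1) / real m * (pi_w N m j - pi_w M m j)
          \<le> 6 * sqrt \<rho> * sqrt (pi_w M m j) + 12 * \<rho>"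
        using cl[of j] \<open>j \<le> i\<close> i by (intro dev[OF c]) auto
      then show "a_w N m j - real (i + 1) / real m * pi_w N m j
        \<le> a_w M m j - real (i + 1) / real m * pi_w M m j + 6 * sqrt \<rho> * sqrt (pi_w M m j) + 12 * \<rho>"
        by (simp add: algebra_simps)
    qed (use i \<rho> u cM M.pi_w_nonneg M.pi_w_le_1 in auto)
    then show ?thesis using E[OF i] by simp
  qed
  have under: "under_loss (a_w N m) (pi_w N m) m i \<le> under_loss (a_w M m) (pi_w M m) m i + E'"
    if i: "i < m" for i
  proof -
    define i' where "i' = m - 1 - i"
    have i': "i' < m" using i by (simp add: i'_def)
    have "under_loss (a_w N m) (pi_w N m) m i \<le> under_loss (a_w M m) (pi_w M m) m i + E i'"
      unfolding E_def under_loss_def i'_def[symmetric]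
    proof (rule over_loss_perturb[OF m])
      fix j assume j: "j \<le> i'"
      have c: "0 \<le> 1 - real (i' + 1) / real m" "1 - real (i' + 1) / real m \<le> 1"
        using i' m by (auto simp: field_simps)
      \<comment> \<open>For the reflected data the excess is \<open>- a + (1 - c) * p\<close> with
        \<open>1 - c\<close> in the unit interval, so \<open>dev\<close> applies with both
        deviations negated.\<close>
      have "- (a_w N m (m - j) - a_w M m (m - j))
          - (1 - real (i' + 1) / real m) * - (pi_w N m (m - j) - pi_w M m (m - j))
          \<le> 6 * sqrt \<rho> * sqrt (pi_w M m (m - j)) + 12 * \<rho>"
        using cl[of "m - j"] by (intro dev[OF c]) (auto simp: abs_minus_commute)
      then show "pi_w N m (m - j) - a_w N m (m - j) - real (i' + 1) / real m * pi_w N m (m - j)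
        \<le> pi_w M m (m - j) - a_w M m (m - j) - real (i' + 1) / real m * pi_w M m (m - j)
          + 6 * sqrt \<rho> * sqrt (pi_w M m (m - j)) + 12 * \<rho>"
        by (simp add: algebra_simps)
    next
      fix i'' assume "i'' \<le> i'"
      with i' show "over_loss (\<lambda>j. pi_w M m (m - j) - a_w M m (m - j)) (\<lambda>j. pi_w M m (m - j)) m i'' \<le> B"
        using cM[of "m - 1 - i''"] by (simp add: under_loss_def)
    qed (use i \<rho> u M.pi_w_nonneg M.pi_w_le_1 in auto)
    then show ?thesis using E[OF i'] by simp
  qed
  show ?thesis
  proof (rule N.SCDL_m_le[OF m])
    show "0 \<le> SCDL_m M m + 2 * (6 * sqrt \<rho> + 12 * real m * \<rho> + (36 * \<rho> / u + u * real m * B) * harm m)"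
      using E'0 M.SCDL_m_nonneg[OF m] by (simp add: E'_def)
    fix i assume "i < m"
    then show "level_loss N m i \<le> SCDL_m M m
      + 2 * (6 * sqrt \<rho> + 12 * real m * \<rho> + (36 * \<rho> / u + u * real m * B) * harm m)"
      using over[of i] under[of i] M.level_loss_le_SCDL_m[of i m]
      unfolding E'_def[symmetric] level_loss_def by simp
  qed
qed

subsection \<open>Comparison of two forecasts\<close>

context forecast
begin

lemma SCDL_le:
  assumes "1 \<le> k"
  shows "SCDL M \<le> max (SCDL_m M (2 ^ k)) (1 / 2 ^ k)"
  unfolding SCDL_def
  by (rule cINF_lower) (use assms in \<open>auto intro!: bdd_belowI2[where m = 0] max.coboundedI2\<close>)

lemma SCDL_ge: "(\<And>k. 1 \<le> k \<Longrightarrow> b \<le> max (SCDL_m M (2 ^ k)) (1 / 2 ^ k)) \<Longrightarrow> b \<le> SCDL M"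
  unfolding SCDL_def by (rule cINF_greatest) auto

lemma SCDL_nonneg: "0 \<le> SCDL M"
  by (rule SCDL_ge) (simp add: max.coboundedI2)

lemma SCDL_le_1: "SCDL M \<le> 1"
  using SCDL_le[of 1] SCDL_2_le_1 by simp

text \<open>A value below \<open>1 / 2 ^ k\<close> in the infimum can only come from a scale finer
  than \<open>2 ^ k\<close>, and by monotonicity the loss there bounds the one at
  \<open>2 ^ k\<close>.\<close>

lemma SCDL_m_eq_0:
  assumes "SCDL M = 0"
  shows "SCDL_m M (2 ^ k) = 0"
proof (rule antisym)
  show "SCDL_m M (2 ^ k) \<le> 0"
  proof (rule field_le_epsilon)
    fix e :: real assume e: "0 < e"
    define b where "b = min e (1 / 2 ^ k)"
    have "0 < b" using e by (simp add: b_def)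
    then have "\<not> b \<le> SCDL M" using assms by simp
    then obtain l where "\<not> b \<le> max (SCDL_m M (2 ^ l)) (1 / 2 ^ l)"
      using SCDL_ge[of b] by blast
    then have l: "max (SCDL_m M (2 ^ l)) (1 / 2 ^ l) < b" by (rule not_le_imp_less)
    then have "(1::real) / 2 ^ l < 1 / 2 ^ k" by (simp add: b_def)
    then have "k \<le> l" by (simp add: field_simps power_strict_increasing_iff)
    with l SCDL_m_pow2_mono[of k l] show "SCDL_m M (2 ^ k) \<le> 0 + e"
      by (simp add: b_def)
  qed
qed (simp add: SCDL_m_nonneg)

end

section \<open>Passage to the infimum over scales\<close>

lemma ex_pow2_ivl:
  fixes x :: real
  assumes "2 \<le> x"
  obtains k where "1 \<le> k" "2 ^ k \<le> x" "x < 2 * 2 ^ k"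
proof -
  obtain n where n: "x < 2 ^ n" using real_arch_pow[of 2 x] by auto
  define N where "N = (LEAST n. x < (2::real) ^ n)"
  have N: "x < 2 ^ N" unfolding N_def by (rule LeastI[of _ n]) (rule n)
  have "N \<noteq> 0" "N \<noteq> 1" by (rule notI, use N assms in simp)+
  then obtain k where k: "N = Suc k" "1 \<le> k" by (cases N) auto
  have "\<not> x < 2 ^ k" by (rule not_less_Least[of k "\<lambda>n. x < 2 ^ n", folded N_def]) (simp add: k)
  with that[of k] k N show ?thesis by simp
qed

text \<open>Since the decision losses increase with the scale, the minimum of
\<open>max (SCDL_m M (2 ^ k)) (1 / 2 ^ k)\<close> is attained where the first entry is at most twice the
second; other scales are compared with a neighbouring one.\<close>

lemma SCDL_transfer:
  assumes M: "forecast M" and N: "forecast N" and s: "0 < s" "s \<le> 1 / 2" and "0 \<le> E"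
    and E: "\<And>k. 1 \<le> k \<Longrightarrow> 2 ^ k \<le> 1 / s \<Longrightarrow> SCDL_m M (2 ^ k) \<le> 2 / 2 ^ k \<Longrightarrow>
      SCDL_m N (2 ^ k) \<le> SCDL_m M (2 ^ k) + E"
  shows "SCDL N \<le> SCDL M + (E + 4 * s)"
proof -
  interpret M: forecast M by fact
  interpret N: forecast N by fact
  have "2 \<le> 1 / s" using s by (simp add: field_simps)
  then obtain K where K: "1 \<le> K" "2 ^ K \<le> 1 / s" "1 / s < 2 * 2 ^ K" by (rule ex_pow2_ivl)
  have K': "2 / 2 ^ K \<le> 4 * s" using K s by (simp add: field_simps)
  have "SCDL N \<le> max (SCDL_m M (2 ^ k)) (1 / 2 ^ k) + (E + 4 * s)" if "1 \<le> k" for k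
    using that
  proof (induction k rule: nat_induct_at_least)
    case base
    have "SCDL_m N (2 ^ 1) \<le> SCDL_m M (2 ^ 1) + E"
      using E[of 1] M.SCDL_2_le_1 \<open>2 \<le> 1 / s\<close> by simp
    then show ?case using N.SCDL_le[of 1] s \<open>0 \<le> E\<close> by (simp add: max_def split: if_splits)
  next
    case (Suc k)
    show ?case
    proof (cases "SCDL_m M (2 ^ Suc k) \<le> 2 / 2 ^ Suc k")
      case False
      \<comment> \<open>The loss at \<open>Suc k\<close> exceeds \<open>1 / 2 ^ k\<close>, so the
        coarser scale \<open>k\<close> is at least as good.\<close>
      then have "max (SCDL_m M (2 ^ k)) (1 / 2 ^ k) \<le> max (SCDL_m M (2 ^ Suc k)) (1 / 2 ^ Suc k)"
        using M.SCDL_m_pow2_mono[of k "Suc k"] by (simp add: le_max_iff_disj)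
      then show ?thesis using Suc.IH by linarith
    next
      case True
      show ?thesis
      proof (cases "2 ^ Suc k \<le> 1 / s")
        case True
        with \<open>SCDL_m M (2 ^ Suc k) \<le> 2 / 2 ^ Suc k\<close>
        have "SCDL_m N (2 ^ Suc k) \<le> SCDL_m M (2 ^ Suc k) + E" by (intro E) auto
        then show ?thesis using N.SCDL_le[of "Suc k"] s \<open>0 \<le> E\<close> by (simp add: max_def split: if_splits)
      next
        case False
        with K have "(2::real) ^ K < 2 ^ Suc k" by linarith
        then have "K \<le> Suc k" using power_strict_increasing_iff[of "2::real" K "Suc k"] by simp
        \<comment> \<open>The scale is too fine for the hypothesis, but its small loss passes to the
          coarser \<open>2 ^ K\<close>, where both entries of the maximum are of order
          \<open>s\<close>.\<close>
        then have "SCDL_m M (2 ^ K) \<le> SCDL_m M (2 ^ Suc k)" by (rule M.SCDL_m_pow2_mono)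
        also have "\<dots> \<le> 2 / 2 ^ Suc k" by fact
        also have "\<dots> \<le> 2 / 2 ^ K" using \<open>K \<le> Suc k\<close>
          by (intro divide_left_mono power_increasing) auto
        finally have MK: "SCDL_m M (2 ^ K) \<le> 2 / 2 ^ K" .
        then have "SCDL_m N (2 ^ K) \<le> SCDL_m M (2 ^ K) + E" using K by (intro E) auto
        moreover have "(1::real) / 2 ^ K \<le> 2 / 2 ^ K" by (intro divide_right_mono) auto
        ultimately have "max (SCDL_m N (2 ^ K)) (1 / 2 ^ K) \<le> 4 * s + E"
          using MK K' \<open>0 \<le> E\<close> by simp
        moreover have "0 \<le> max (SCDL_m M (2 ^ Suc k)) (1 / 2 ^ Suc k)" by (simp add: max.coboundedI2)
        ultimately show ?thesis using N.SCDL_le[of K] K by linarith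
      qed
    qed
  qed
  then have "SCDL N - (E + 4 * s) \<le> SCDL M" by (intro M.SCDL_ge) (simp add: algebra_simps)
  then show ?thesis by simp
qed

lemma ln_inverse_ge: "0 < r \<Longrightarrow> 1 - r \<le> ln (1 / r)" for r :: real
  using ln_le_minus_one[of r] by (simp add: ln_div)

lemma harm_le_ln_inverse:
  assumes "0 < r" "1 \<le> ln (1 / r)" "1 \<le> m" "real m \<le> 1 / sqrt r"
  shows "harm m \<le> 2 * ln (1 / r)"
proof -
  have "ln (real m) \<le> ln (1 / sqrt r)" using assms by (subst ln_le_cancel_iff) auto
  also have "\<dots> = ln (1 / r) / 2" using assms by (simp add: ln_div ln_sqrt)
  finally show ?thesis using harm_le_ln[of m] assms by linarith
qed

lemma sqrt_6_mult_le: "0 \<le> r \<Longrightarrow> sqrt (6 * r) \<le> 3 * sqrt r"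
proof -
  assume "0 \<le> r"
  then have "sqrt (6 * r) \<le> sqrt (9 * r)" by simp
  also have "\<dots> = 3 * sqrt r" by (simp add: real_sqrt_mult)
  finally show ?thesis .
qed

lemma SCDL_perturb:
  assumes M: "forecast M" and N: "forecast N" and r: "0 < r" "r < 1 / 2"
    and close: "\<And>m. 1 \<le> m \<Longrightarrow> real m \<le> 1 / sqrt r \<Longrightarrow> close (6 * r) M N m"
  shows "SCDL N \<le> SCDL M + 1056 * sqrt r * ln (1 / r)"
proof (cases "sqrt r \<le> 1 / 2")
  case False
  \<comment> \<open>For large \<open>r\<close> the claim is trivial, as \<open>SCDL\<close> is at
    most 1.\<close>
  then have "1 / 2 * (1 / 2) \<le> sqrt r * ln (1 / r)"
    using r ln_inverse_ge[of r] by (intro mult_mono) auto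
  then show ?thesis
    using forecast.SCDL_le_1[OF N] forecast.SCDL_nonneg[OF M] by linarith
next
  case True
  have "r \<le> 1 / 4" using power_mono[OF True, of 2] r by (simp add: power2_eq_square)
  have l: "1 \<le> ln (1 / r)"
  proof -
    have "exp 1 \<le> (4::real)" using exp_le by simp
    also have "4 \<le> 1 / r" using r \<open>r \<le> 1 / 4\<close> by (simp add: field_simps)
    finally show ?thesis using r by (simp add: ln_ge_iff)
  qed
  \<comment> \<open>1052 = 2 * (18 + 72 + 436), the three error terms of
    \<open>SCDL_m_perturb\<close>; the missing \<open>4 * sqrt r\<close> comes from
    \<open>SCDL_transfer\<close>.\<close>
  define E where "E = 1052 * sqrt r * ln (1 / r)"
  have "SCDL N \<le> SCDL M + (E + 4 * sqrt r)"
  proof (rule SCDL_transfer[OF M N])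
    show "0 \<le> E" using r l by (simp add: E_def)
    fix k :: nat assume k: "1 \<le> k" "2 ^ k \<le> 1 / sqrt r" "SCDL_m M (2 ^ k) \<le> 2 / 2 ^ k"
    define m :: nat where "m = 2 ^ k"
    have m: "1 \<le> m" "real m \<le> 1 / sqrt r" "SCDL_m M m \<le> 2 / real m"
      using k by (auto simp: m_def)
    have "0 < m" using m by simp
    \<comment> \<open>With \<open>B = 2 / m\<close> the choice \<open>u = sqrt r\<close> makes both
      \<open>r / u\<close> and \<open>u * m * B\<close> of order \<open>sqrt r\<close>.\<close>
    have "SCDL_m N m \<le> SCDL_m M m
      + 2 * (6 * sqrt (6 * r) + 12 * real m * (6 * r) + (36 * (6 * r) / sqrt r + sqrt r * real m * (2 / real m)) * harm m)"
      by (rule SCDL_m_perturb[OF M N close[OF m(1,2)] \<open>0 < m\<close> _ _ _ m(3)])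
         (use r m in \<open>auto simp: field_simps\<close>)
    moreover have "real m * r \<le> sqrt r"
    proof -
      have "real m * r \<le> 1 / sqrt r * r" using m r by (intro mult_right_mono) auto
      also have "\<dots> = sqrt r" using r by (simp add: real_div_sqrt)
      finally show ?thesis .
    qed
    moreover have "(36 * (6 * r) / sqrt r + sqrt r * real m * (2 / real m)) * harm m = 218 * (sqrt r * harm m)"
    proof -
      have "36 * (6 * r) / sqrt r = 216 * (r / sqrt r)" by simp
      then have "36 * (6 * r) / sqrt r = 216 * sqrt r" using r by (simp add: real_div_sqrt)
      then show ?thesis using m by simp
    qed
    moreover have "sqrt r * harm m \<le> sqrt r * (2 * ln (1 / r))"
      using r harm_le_ln_inverse[OF r(1) l m(1,2)] by (intro mult_left_mono) auto
    moreover have "sqrt r * 1 \<le> sqrt r * ln (1 / r)" using r l by (intro mult_left_mono) auto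
    moreover have "sqrt (6 * r) \<le> 3 * sqrt r" using r by (intro sqrt_6_mult_le) simp
    ultimately have "SCDL_m N m \<le> SCDL_m M m + E" unfolding E_def by argo
    then show "SCDL_m N (2 ^ k) \<le> SCDL_m M (2 ^ k) + E" by (simp add: m_def)
  qed (use r True in auto)
  moreover have "sqrt r * 1 \<le> sqrt r * ln (1 / r)" using r l by (intro mult_left_mono) auto
  ultimately show ?thesis unfolding E_def by argo
qed

text \<open>All losses of \<open>M\<close> vanish, so \<open>B = 0\<close> and \<open>u\<close> can
  take its largest value \<open>1 / m\<close>. The error is then of order
  \<open>sqrt r + m * r * ln (1 / r)\<close>, which \<open>m\<close> of order \<open>1 / x\<close>
  balances against \<open>1 / m\<close>.\<close>

lemma SCDL_perturb_zero:
  assumes M: "forecast M" and N: "forecast N" and r: "0 < r" "r < 1 / 2" and zero: "SCDL M = 0"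
    and close: "\<And>m. 1 \<le> m \<Longrightarrow> real m \<le> 1 / sqrt r \<Longrightarrow> close (6 * r) M N m"
  shows "SCDL N \<le> 1056 * sqrt (r * ln (1 / r))"
proof -
  define x where "x = sqrt (r * ln (1 / r))"
  have l0: "1 / 2 \<le> ln (1 / r)" using ln_inverse_ge[of r] r by simp
  then have x2: "x\<^sup>2 = r * ln (1 / r)" and x0: "0 < x" using r by (auto simp: x_def)
  show ?thesis
  proof (cases "x \<le> 1 / 4")
    case False
    then show ?thesis using forecast.SCDL_le_1[OF N] by (simp add: x_def)
  next
    case True
    have l: "1 \<le> ln (1 / r)"
    proof (rule ccontr)
      \<comment> \<open>Otherwise \<open>r \<ge> 1 / 3\<close>, making \<open>x\<close> larger than
        \<open>1 / 4\<close>.\<close>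
      assume "\<not> 1 \<le> ln (1 / r)"
      then have "1 / r < exp 1" using r by (simp add: ln_ge_iff)
      then have "1 < r * exp 1" using r by (simp add: field_simps)
      also have "\<dots> \<le> r * 3" using exp_le r by (intro mult_left_mono) auto
      finally have "1 / 3 \<le> r" by simp
      then have "1 / 3 * (1 / 2) \<le> x\<^sup>2" unfolding x2 using l0 r by (intro mult_mono) auto
      moreover have "x\<^sup>2 \<le> (1 / 4)\<^sup>2" using True x0 by (intro power_mono) auto
      ultimately show False by (simp add: power2_eq_square)
    qed
    have "2 \<le> 1 / x" using True x0 by (simp add: field_simps)
    then obtain k where k: "1 \<le> k" "2 ^ k \<le> 1 / x" "1 / x < 2 * 2 ^ k" by (rule ex_pow2_ivl)
    define m :: nat where "m = 2 ^ k"
    have m: "1 \<le> m" "real m \<le> 1 / x" "1 / real m \<le> 2 * x" "0 < m"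
      using k x0 by (auto simp: m_def field_simps)
    have sx: "sqrt r \<le> x" unfolding x_def using r l mult_left_mono[OF l, of r] by simp
    then have "1 / x \<le> 1 / sqrt r" using r by (intro divide_left_mono) (auto simp: x0)
    then have m2: "real m \<le> 1 / sqrt r" using m by simp
    have "SCDL_m N m \<le> SCDL_m M m
      + 2 * (6 * sqrt (6 * r) + 12 * real m * (6 * r) + (36 * (6 * r) / (1 / real m) + 1 / real m * real m * 0) * harm m)"
      by (rule SCDL_m_perturb[OF M N close[OF m(1) m2] \<open>0 < m\<close>])
         (use r m forecast.SCDL_m_eq_0[OF M zero] in \<open>auto simp: m_def\<close>)
    moreover have "SCDL_m M m = 0" unfolding m_def by (rule forecast.SCDL_m_eq_0[OF M zero])
    moreover have rml: "real m * r * ln (1 / r) \<le> x"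
    proof -
      have "real m * (r * ln (1 / r)) \<le> 1 / x * (r * ln (1 / r))"
        using m r l by (intro mult_right_mono) auto
      also have "\<dots> = x" using x0 unfolding x2[symmetric] by (simp add: power2_eq_square)
      finally show ?thesis by (simp add: mult.assoc)
    qed
    moreover have "real m * r * harm m \<le> real m * r * (2 * ln (1 / r))"
      using r harm_le_ln_inverse[OF r(1) l m(1) m2] by (intro mult_left_mono) auto
    moreover have "real m * r * 1 \<le> real m * r * ln (1 / r)" using r l by (intro mult_left_mono) auto
    moreover have "sqrt (6 * r) \<le> 3 * sqrt r" using r by (intro sqrt_6_mult_le) simp
    moreover have "(36 * (6 * r) / (1 / real m) + 1 / real m * real m * 0) * harm m = 216 * (real m * r * harm m)"
      by simp
    ultimately have "SCDL_m N m \<le> 1044 * x" using sx by argo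
    then show ?thesis
      using forecast.SCDL_le[OF N k(1)] m(3) x0 unfolding x_def[symmetric] by (simp add: m_def)
  qed
qed

text \<open>The first direction merely weakens the constants. For the second, the deviation bound
  itself shows that the masses are comparable up to a multiple of \<open>\<rho>\<close>.\<close>

lemma close_if_deviation:
  assumes M: "forecast M" and N: "forecast N" and \<rho>: "0 \<le> \<rho>"
    and "\<And>j. j \<le> m \<Longrightarrow> \<bar>pi_w N m j - pi_w M m j\<bar> \<le> 2 * sqrt (pi_w M m j * \<rho>) + \<rho>"
    and "\<And>j. j \<le> m \<Longrightarrow> \<bar>a_w N m j - a_w M m j\<bar> \<le> 2 * sqrt (pi_w M m j * \<rho>) + \<rho>"
  shows "close \<rho> M N m" "close \<rho> N M m"
proof -
  have sym: "2 * sqrt (p * \<rho>) + \<rho> \<le> 3 * sqrt (q * \<rho>) + 6 * \<rho>"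
    if pq: "0 \<le> p" "0 \<le> q" "\<bar>q - p\<bar> \<le> 2 * sqrt (p * \<rho>) + \<rho>" for p q
  proof -
    have "0 \<le> (sqrt p - 2 * sqrt \<rho>)\<^sup>2" by simp
    then have "4 * sqrt (p * \<rho>) \<le> p + 4 * \<rho>"
      using pq \<rho> by (simp add: power2_diff real_sqrt_mult power_mult_distrib algebra_simps)
    then have "p \<le> 2 * q + 6 * \<rho>" using pq by linarith
    then have "p * \<rho> \<le> (2 * q + 6 * \<rho>) * \<rho>" using \<rho> by (intro mult_right_mono)
    also have "\<dots> = 2 * (sqrt (q * \<rho>))\<^sup>2 + 6 * \<rho>\<^sup>2"
      using pq \<rho> by (simp add: power2_eq_square[of \<rho>] algebra_simps)
    \<comment> \<open>Completing to the square of
      \<open>3 / 2 * sqrt (q * \<rho>) + 5 / 2 * \<rho>\<close>; doubling this and adding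
      \<open>\<rho>\<close> gives the constants 3 and 6.\<close>
    also have "\<dots> \<le> 9 / 4 * (sqrt (q * \<rho>))\<^sup>2 + 15 / 2 * (sqrt (q * \<rho>) * \<rho>) + 25 / 4 * \<rho>\<^sup>2"
      using pq \<rho> by (intro add_mono order_trans[OF _ add_increasing2] mult_right_mono) auto
    also have "\<dots> = (3 / 2 * sqrt (q * \<rho>) + 5 / 2 * \<rho>)\<^sup>2"
      by (simp only: power2_eq_square) (simp add: algebra_simps del: real_sqrt_mult_self)
    finally have "sqrt (p * \<rho>) \<le> 3 / 2 * sqrt (q * \<rho>) + 5 / 2 * \<rho>"
      using pq \<rho> by (intro real_le_lsqrt) auto
    then show ?thesis by simp
  qed
  have nonneg: "0 \<le> pi_w M m j" "0 \<le> pi_w N m j" "0 \<le> sqrt (pi_w M m j * \<rho>)" for j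
    using forecast.pi_w_nonneg M N \<rho> by auto
  show "close \<rho> M N m"
    unfolding close_def using assms(4,5) nonneg \<rho> by (smt (verit))
  show "close \<rho> N M m"
    unfolding close_def
  proof safe
    fix j assume j: "j \<le> m"
    note s = sym[OF nonneg(1,2) assms(4)[OF j]]
    show "\<bar>pi_w M m j - pi_w N m j\<bar> \<le> 3 * sqrt (pi_w N m j * \<rho>) + 6 * \<rho>"
      using s assms(4)[OF j] by (simp add: abs_minus_commute)
    show "\<bar>a_w M m j - a_w N m j\<bar> \<le> 3 * sqrt (pi_w N m j * \<rho>) + 6 * \<rho>"
      using s assms(5)[OF j] by (simp add: abs_minus_commute)
  qed
qed

subsection \<open>Concentration\<close>

lemma exp_le_quadratic:
  fixes y :: real
  assumes "\<bar>y\<bar> \<le> 1"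
  shows "exp y \<le> 1 + y + y\<^sup>2"
proof (cases "0 \<le> y")
  case True
  then show ?thesis using exp_bound[of y] assms by simp
next
  case False
  \<comment> \<open>The product equals \<open>1 - y^3\<close>, and
    \<open>1 - y \<le> exp (- y)\<close>.\<close>
  have "1 \<le> (1 + y + y\<^sup>2) * (1 - y)"
    using False by (simp add: algebra_simps power2_eq_square mult_nonpos_nonneg)
  also have "\<dots> \<le> (1 + y + y\<^sup>2) * exp (- y)"
    using False assms exp_ge_add_one_self[of "- y"] by (intro mult_left_mono) auto
  finally show ?thesis by (simp add: exp_minus field_simps)
qed

text \<open>Since \<open>f^2 \<le> f\<close>, the mean replaces the second moment in the quadratic
  term; this makes the deviations scale with the square root of the cell mass.\<close>

lemma (in prob_space) expectation_exp_le:
  fixes f :: "'a \<Rightarrow> real"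
  assumes [measurable]: "f \<in> borel_measurable M" and f: "\<And>x. 0 \<le> f x" "\<And>x. f x \<le> 1" and c: "\<bar>c\<bar> \<le> 1"
  shows "expectation (\<lambda>x. exp (c * f x)) \<le> exp ((c + c\<^sup>2) * expectation f)"
    and "integrable M (\<lambda>x. exp (c * f x))"
proof -
  have cf: "\<bar>c * f x\<bar> \<le> 1" for x
    unfolding abs_mult using c f by (intro mult_le_one) auto
  have f_int: "integrable M f"
    by (rule integrable_const_bound[where B = 1]) (use f in auto)
  show int: "integrable M (\<lambda>x. exp (c * f x))"
    by (rule integrable_const_bound[where B = "exp 1"])
       (use cf in \<open>auto simp: abs_le_iff\<close>)
  have "exp (c * f x) \<le> 1 + (c + c\<^sup>2) * f x" for x
  proof -
    have "(f x)\<^sup>2 \<le> f x" using f[of x] by (simp add: power2_eq_square mult_left_le)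
    then have "c\<^sup>2 * (f x)\<^sup>2 \<le> c\<^sup>2 * f x" by (intro mult_left_mono) auto
    then show ?thesis using exp_le_quadratic[OF cf[of x]] by (simp add: power_mult_distrib algebra_simps)
  qed
  then have "expectation (\<lambda>x. exp (c * f x)) \<le> expectation (\<lambda>x. 1 + (c + c\<^sup>2) * f x)"
    using f_int by (intro integral_mono int) auto
  also have "\<dots> = 1 + (c + c\<^sup>2) * expectation f" using f_int by (simp add: prob_space)
  also have "\<dots> \<le> exp ((c + c\<^sup>2) * expectation f)" by (rule exp_ge_add_one_self)
  finally show "expectation (\<lambda>x. exp (c * f x)) \<le> exp ((c + c\<^sup>2) * expectation f)" .
qed

text \<open>Markov's inequality for the exponential moment, which factorises by independence; the
  sign \<open>\<sigma>\<close> selects the tail.\<close>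

lemma (in prob_space) Bernstein_tail:
  fixes f :: "'a \<Rightarrow> real" and T :: nat
  assumes f_meas [measurable]: "f \<in> borel_measurable M" and f: "\<And>x. 0 \<le> f x" "\<And>x. f x \<le> 1"
    and \<sigma>: "\<bar>\<sigma>\<bar> = 1" and \<rho>: "0 < \<rho>"
  defines "\<mu> \<equiv> expectation f" and "P \<equiv> PiM {..<T} (\<lambda>_. M)"
  shows "measure P {\<omega>\<in>space P. real T * (2 * sqrt (\<mu> * \<rho>) + \<rho>) \<le> \<sigma> * ((\<Sum>t<T. f (\<omega> t)) - real T * \<mu>)}
    \<le> exp (- real T * \<rho>)"
proof -
  interpret PP: product_prob_space "\<lambda>_. M" "{..<T}" ..
  have \<mu>: "0 \<le> \<mu>" unfolding \<mu>_def using f by simp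
  \<comment> \<open>\<open>sqrt (\<rho> / \<mu>)\<close> minimises
    \<open>l^2 * \<mu> - 2 * l * sqrt (\<mu> * \<rho>)\<close>, with value \<open>- \<rho>\<close>.
    If it exceeds the admissible 1, then \<open>l = 1\<close> works thanks to the additive
    \<open>\<rho>\<close> in the deviation.\<close>
  obtain l where l: "0 < l" "l \<le> 1" "l\<^sup>2 * \<mu> - l * (2 * sqrt (\<mu> * \<rho>) + \<rho>) \<le> - \<rho>"
  proof (cases "\<rho> \<le> \<mu>")
    case True
    have "sqrt (\<rho> / \<mu>) * sqrt (\<mu> * \<rho>) = \<rho>"
      using True \<rho> by (simp flip: real_sqrt_mult add: power2_eq_square[symmetric])
    moreover have "0 \<le> sqrt (\<rho> / \<mu>) * \<rho>" using True \<rho> by simp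
    ultimately show ?thesis using True \<rho> by (intro that[of "sqrt (\<rho> / \<mu>)"]) (auto simp: algebra_simps)
  next
    case False
    then have "\<mu> * \<mu> \<le> \<mu> * \<rho>" using \<mu> by (intro mult_left_mono) auto
    then have "\<mu> \<le> sqrt (\<mu> * \<rho>)" using \<mu> by (intro real_le_rsqrt) (simp add: power2_eq_square)
    then show ?thesis using \<mu> by (intro that[of 1]) auto
  qed
  define c where "c = \<sigma> * l"
  have c: "\<bar>c\<bar> \<le> 1" "c\<^sup>2 = l\<^sup>2"
    using \<sigma> l power2_abs[of \<sigma>] by (auto simp: c_def abs_mult power_mult_distrib)
  define s where "s = 2 * sqrt (\<mu> * \<rho>) + \<rho>"
  define u where "u \<omega> = (\<Prod>t<T. exp (c * f (\<omega> t)))" for \<omega> :: "nat \<Rightarrow> 'a"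
  note e = expectation_exp_le[OF f_meas f c(1)]
  have u_int: "integrable P u"
    unfolding u_def P_def by (intro PP.product_integrable_prod e) simp
  have [measurable]: "Measurable.pred P (\<lambda>\<omega>. exp (c * (real T * \<mu>) + l * (real T * s)) \<le> u \<omega>)"
    using u_int by measurable
  have "(\<integral>\<omega>. u \<omega> \<partial>P) = expectation (\<lambda>x. exp (c * f x)) ^ T"
    unfolding u_def P_def by (subst PP.product_integral_prod) (use e in auto)
  also have "\<dots> \<le> exp ((c + c\<^sup>2) * \<mu>) ^ T"
    unfolding \<mu>_def by (intro power_mono e) simp
  finally have u_le: "(\<integral>\<omega>. u \<omega> \<partial>P) \<le> exp (real T * ((c + c\<^sup>2) * \<mu>))"
    by (simp add: exp_of_nat_mult)
  have "{\<omega>\<in>space P. real T * s \<le> \<sigma> * ((\<Sum>t<T. f (\<omega> t)) - real T * \<mu>)}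
      \<subseteq> {\<omega>\<in>space P. exp (c * (real T * \<mu>) + l * (real T * s)) \<le> u \<omega>}"
  proof safe
    fix \<omega> assume "real T * s \<le> \<sigma> * ((\<Sum>t<T. f (\<omega> t)) - real T * \<mu>)"
    then have "l * (real T * s) \<le> l * (\<sigma> * ((\<Sum>t<T. f (\<omega> t)) - real T * \<mu>))"
      using l by (intro mult_left_mono) auto
    then have "c * (real T * \<mu>) + l * (real T * s) \<le> c * (\<Sum>t<T. f (\<omega> t))"
      by (simp add: c_def algebra_simps)
    then show "exp (c * (real T * \<mu>) + l * (real T * s)) \<le> u \<omega>"
      by (simp add: u_def sum_distrib_left flip: exp_sum)
  qed
  then have "measure P {\<omega>\<in>space P. real T * s \<le> \<sigma> * ((\<Sum>t<T. f (\<omega> t)) - real T * \<mu>)}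
      \<le> measure P {\<omega>\<in>space P. exp (c * (real T * \<mu>) + l * (real T * s)) \<le> u \<omega>}"
    unfolding P_def[symmetric] by (intro PP.finite_measure_mono[folded P_def]) auto
  also have "\<dots> \<le> (\<integral>\<omega>. u \<omega> \<partial>P) / exp (c * (real T * \<mu>) + l * (real T * s))"
    by (intro integral_Markov_inequality_measure[where A = "{}"] u_int) (auto simp: u_def prod_nonneg)
  also have "\<dots> \<le> exp (real T * ((c + c\<^sup>2) * \<mu>)) / exp (c * (real T * \<mu>) + l * (real T * s))"
    using u_le by (intro divide_right_mono) auto
  also have "\<dots> = exp (real T * (l\<^sup>2 * \<mu> - l * s))"
    by (simp add: c algebra_simps flip: exp_diff)
  also have "\<dots> \<le> exp (real T * (- \<rho>))"
    unfolding s_def exp_le_cancel_iff by (intro mult_left_mono l) simp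
  finally show ?thesis by (simp add: s_def)
qed

section \<open>Empirical measures and the good event\<close>

lemma forecast_borel:
  fixes D :: "(real \<times> bool) measure"
  assumes "prob_space D" and sets: "sets D = sets borel" and D: "measure D ({0..1} \<times> UNIV) = 1"
  shows "forecast D"
proof -
  interpret prob_space D by fact
  show ?thesis
  proof
    show "fst \<in> borel_measurable D"
      unfolding measurable_cong_sets[OF sets refl]
      by (intro borel_measurable_continuous_onI continuous_intros)
    have "snd -` {True} \<in> sets (borel :: (real \<times> bool) measure)"
      by (intro borel_open open_vimage continuous_intros Topological_Spaces.open_discrete)
    then have "{x \<in> space D. snd x} \<in> sets D"
      using sets sets_eq_imp_space_eq[OF sets] by (simp add: vimage_def)
    then show "Measurable.pred D snd" by (simp add: pred_def)
    have "AE x in D. x \<in> {0..1} \<times> UNIV" using D by (rule AE_prob_1)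
    then show "AE x in D. fst x \<in> {0..1}" by eventually_elim auto
  qed
qed

lemma integral_empirical:
  fixes f :: "real \<times> bool \<Rightarrow> real"
  assumes "0 < T"
  shows "(\<integral>x. f x \<partial>empirical \<omega> T) = (\<Sum>t<T. f (\<omega> t)) / real T"
  using assms by (simp add: empirical_def integral_pmf_of_set lessThan_empty_iff)

lemma forecast_empirical:
  assumes "0 < T" "\<And>t. t < T \<Longrightarrow> fst (\<omega> t) \<in> {0..1}"
  shows "forecast (empirical \<omega> T)"
proof -
  interpret prob_space "empirical \<omega> T"
    unfolding empirical_def by (rule measure_pmf.prob_space_axioms)
  show ?thesis
  proof
    have "set_pmf (pmf_of_set {..<T}) = {..<T}" using assms by (intro set_pmf_of_set) auto
    then show "AE x in empirical \<omega> T. fst x \<in> {0..1}"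
      unfolding empirical_def AE_measure_pmf_iff using assms(2) by (auto simp: set_map_pmf)
  qed (auto simp: empirical_def)
qed

text \<open>The flag lets one union bound treat cell masses and label masses together.\<close>

definition cell :: "nat \<Rightarrow> nat \<Rightarrow> bool \<Rightarrow> real \<times> bool \<Rightarrow> real" where
  "cell m j b x = rw m j (fst x) * (if b then of_bool (snd x) else 1)"

lemma pi_w_eq_cell: "pi_w M m j = (\<integral>x. cell m j False x \<partial>M)"
  and a_w_eq_cell: "a_w M m j = (\<integral>x. cell m j True x \<partial>M)"
  by (simp_all add: pi_w_def a_w_def cell_def)

text \<open>A union bound over scale, cell, kind of mass and sign of the deviation. Samples with a
  forecast outside the unit interval, a null set, are removed as well, so that every remaining
  empirical measure is a \<open>forecast\<close>.\<close>

lemma (in forecast) good_sample: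
  fixes T :: nat and \<rho> :: real
  assumes T: "0 < T" and \<rho>: "0 < \<rho>"
  defines "P \<equiv> PiM {..<T} (\<lambda>_. M)"
  obtains A where "A \<in> sets P" "1 - real (4 * T * (T + 1)) * exp (- real T * \<rho>) \<le> measure P A"
    "\<And>\<omega>. \<omega> \<in> A \<Longrightarrow> forecast (empirical \<omega> T)"
    "\<And>\<omega> m. \<omega> \<in> A \<Longrightarrow> 1 \<le> m \<Longrightarrow> m \<le> T \<Longrightarrow>
        close \<rho> M (empirical \<omega> T) m \<and> close \<rho> (empirical \<omega> T) M m"
proof -
  have P_prob: "prob_space P" unfolding P_def by (intro prob_space_PiM prob_space_axioms)
  interpret P: prob_space P by (rule P_prob)
  define \<mu> where "\<mu> = (\<lambda>(m, j, b). \<integral>x. cell m j b x \<partial>M)"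
  define dev where "dev = (\<lambda>z. 2 * sqrt (\<mu> z * \<rho>) + \<rho>)"
  define U where "U = (\<lambda>(z, \<sigma>). {\<omega>\<in>space P. real T * dev z \<le> \<sigma> * ((\<Sum>t<T. (case z of (m, j, b) \<Rightarrow> cell m j b) (\<omega> t)) - real T * \<mu> z)})"
  define I where "I = ({1..T} \<times> {..T} \<times> (UNIV :: bool set)) \<times> {- 1, 1 :: real}"
  have I: "finite I" "card I = 4 * T * (T + 1)"
    by (simp_all add: I_def card_cartesian_product)
  have [measurable]: "cell m j b \<in> borel_measurable M" for m j b
    unfolding cell_def[abs_def] by measurable
  have comp: "(\<lambda>\<omega>. \<omega> t) \<in> measurable P M" if "t < T" for t
    unfolding P_def using that by simp
  have U_sets: "U i \<in> sets P" for i
  proof -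
    obtain m j b \<sigma> where i: "i = ((m, j, b), \<sigma>)" by (metis prod.exhaust)
    have *: "(\<lambda>\<omega>. \<Sum>t<T. cell m j b (\<omega> t)) \<in> borel_measurable P"
      by (intro borel_measurable_sum measurable_compose[OF comp]) auto
    then show ?thesis unfolding U_def i prod.case
      by (intro borel_measurable_le borel_measurable_times borel_measurable_diff borel_measurable_const *)
  qed
  have U_le: "measure P (U i) \<le> exp (- real T * \<rho>)" if "i \<in> I" for i
  proof -
    obtain m j b \<sigma> where i: "i = ((m, j, b), \<sigma>)" by (metis prod.exhaust)
    have "\<bar>\<sigma>\<bar> = 1" using that by (auto simp: i I_def)
    then have "measure P {\<omega>\<in>space P. real T * (2 * sqrt (expectation (cell m j b) * \<rho>) + \<rho>)
        \<le> \<sigma> * ((\<Sum>t<T. cell m j b (\<omega> t)) - real T * expectation (cell m j b))} \<le> exp (- real T * \<rho>)"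
      unfolding P_def by (intro Bernstein_tail \<rho>) (auto simp: cell_def rw_nonneg rw_le_1)
    then show ?thesis by (simp add: U_def dev_def \<mu>_def i)
  qed
  define G where "G = {\<omega>\<in>space P. \<forall>t\<in>{..<T}. fst (\<omega> t) \<in> {0..1}}"
  have G_sets: "G \<in> sets P"
  proof -
    have "{\<omega>\<in>space P. fst (\<omega> t) \<in> {0..1}} \<in> sets P" if "t \<in> {..<T}" for t
    proof -
      have "(\<lambda>\<omega>. fst (\<omega> t)) -` {0..1} \<inter> space P \<in> sets P"
        by (intro measurable_sets[OF measurable_compose[OF comp fst_measurable]]) (use that in auto)
      also have "(\<lambda>\<omega>. fst (\<omega> t)) -` {0..1} \<inter> space P = {\<omega>\<in>space P. fst (\<omega> t) \<in> {0..1}}" by auto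
      finally show ?thesis .
    qed
    then show ?thesis unfolding G_def by (intro sets.sets_Collect_finite_All) auto
  qed
  have "AE \<omega> in P. \<forall>t\<in>{..<T}. fst (\<omega> t) \<in> {0..1}"
  proof (rule AE_finite_allI)
    fix t assume "t \<in> {..<T}"
    then show "AE \<omega> in P. fst (\<omega> t) \<in> {0..1}"
      unfolding P_def by (intro AE_PiM_component[where P = "\<lambda>x. fst x \<in> {0..1}"] prob_space_axioms range)
  qed simp
  then have G_prob: "measure P G = 1" using G_sets unfolding G_def by (intro P.prob_Collect_eq_1[THEN iffD2])
  define A where "A = G - (\<Union>i\<in>I. U i)"
  have "measure P (\<Union>i\<in>I. U i) \<le> (\<Sum>i\<in>I. measure P (U i))"
    by (rule P.finite_measure_subadditive_finite) (use I U_sets in auto)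
  also have "\<dots> \<le> (\<Sum>i\<in>I. exp (- real T * \<rho>))" by (intro sum_mono U_le)
  also have "\<dots> = real (4 * T * (T + 1)) * exp (- real T * \<rho>)" by (simp add: I)
  finally have bad: "measure P (\<Union>i\<in>I. U i) \<le> real (4 * T * (T + 1)) * exp (- real T * \<rho>)" .
  have UN_sets: "(\<Union>i\<in>I. U i) \<in> sets P" using I U_sets by auto
  show ?thesis
  proof (rule that)
    show "A \<in> sets P" unfolding A_def using G_sets UN_sets by auto
    have "measure P G \<le> measure P (A \<union> (\<Union>i\<in>I. U i))"
      using G_sets UN_sets by (intro P.finite_measure_mono) (auto simp: A_def)
    also have "\<dots> \<le> measure P A + measure P (\<Union>i\<in>I. U i)"
      by (rule measure_Un_le) fact+
    finally show "1 - real (4 * T * (T + 1)) * exp (- real T * \<rho>) \<le> measure P A"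
      using bad G_prob by simp
    fix \<omega> assume \<omega>: "\<omega> \<in> A"
    then show N: "forecast (empirical \<omega> T)"
      by (intro forecast_empirical T) (auto simp: A_def G_def)
    fix m assume m: "1 \<le> m" "m \<le> T"
    have deviation: "\<bar>(\<integral>x. cell m j b x \<partial>empirical \<omega> T) - expectation (cell m j b)\<bar>
        \<le> 2 * sqrt (expectation (cell m j b) * \<rho>) + \<rho>" if "j \<le> m" for j b
    proof -
      have "\<omega> \<in> space P" "\<omega> \<notin> U ((m, j, b), \<sigma>)" if "\<sigma> \<in> {- 1, 1}" for \<sigma>
        using \<omega> \<open>j \<le> m\<close> m that by (auto simp: A_def G_def I_def)
      from this(1)[of 1] this(2)[of 1] this(2)[of "- 1"]
      have "\<bar>(\<Sum>t<T. cell m j b (\<omega> t)) - real T * expectation (cell m j b)\<bar>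
          \<le> real T * (2 * sqrt (expectation (cell m j b) * \<rho>) + \<rho>)"
        by (simp add: U_def \<mu>_def dev_def abs_le_iff)
      moreover have "(\<integral>x. cell m j b x \<partial>empirical \<omega> T) - expectation (cell m j b)
          = ((\<Sum>t<T. cell m j b (\<omega> t)) - real T * expectation (cell m j b)) / real T"
        using T by (simp add: integral_empirical diff_divide_distrib)
      ultimately show ?thesis using T by (simp add: pos_divide_le_eq mult.commute)
    qed
    \<comment> \<open>The tail bound for label masses involves \<open>a_w\<close>; it is relaxed to
      \<open>pi_w\<close>, as \<open>close\<close> requires.\<close>
    have "sqrt (a_w M m j * \<rho>) \<le> sqrt (pi_w M m j * \<rho>)" for j
      using a_w_le_pi_w[of m j] \<rho> by simp
    then have "\<bar>a_w (empirical \<omega> T) m j - a_w M m j\<bar> \<le> 2 * sqrt (pi_w M m j * \<rho>) + \<rho>" if "j \<le> m" for j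
      using deviation[OF that, of True] unfolding a_w_eq_cell[symmetric] by (smt (verit))
    moreover have "\<bar>pi_w (empirical \<omega> T) m j - pi_w M m j\<bar> \<le> 2 * sqrt (pi_w M m j * \<rho>) + \<rho>" if "j \<le> m" for j
      using deviation[OF that, of False] unfolding pi_w_eq_cell .
    ultimately show "close \<rho> M (empirical \<omega> T) m \<and> close \<rho> (empirical \<omega> T) M m"
      using close_if_deviation[OF forecast_axioms N less_imp_le[OF \<rho>]] by blast
  qed
qed

text \<open>With \<open>\<rho> = 6 * r\<close> each event has probability at most
  \<open>\<delta>^6\<close>. The number of events is at most \<open>T^5\<close>, and
  \<open>T * \<delta> < 1\<close> absorbs it.\<close>

lemma union_bound_le:
  fixes T :: nat and \<delta> :: real
  assumes T: "2 \<le> T" and \<delta>: "0 < \<delta>" "\<delta> < 1 / real T"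
  shows "real (4 * T * (T + 1)) * exp (- real T * (6 * (ln (1 / \<delta>) / real T))) \<le> \<delta>"
proof -
  have "exp (- real T * (6 * (ln (1 / \<delta>) / real T))) = exp (6 * ln \<delta>)"
    using T \<delta> by (simp add: ln_div)
  also have "\<dots> = \<delta> ^ 6"
    using \<delta> exp_of_nat_mult[of 6 "ln \<delta>"] by simp
  finally have e: "exp (- real T * (6 * (ln (1 / \<delta>) / real T))) = \<delta> ^ 6" .
  have "real (4 * T * (T + 1)) \<le> real T ^ 5"
  proof -
    have "4 * T * (T + 1) \<le> 8 * T ^ 2" using T by (simp add: power2_eq_square)
    also have "\<dots> \<le> T ^ 3 * T ^ 2" using power_mono[OF T, of 3] by (intro mult_right_mono) auto
    also have "\<dots> = T ^ 5" by (simp flip: power_add)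
    finally show ?thesis by (metis of_nat_le_iff of_nat_power)
  qed
  then have "real (4 * T * (T + 1)) * \<delta> ^ 6 \<le> real T ^ 5 * \<delta> ^ 6"
    using \<delta> by (intro mult_right_mono) auto
  also have "\<dots> = (real T * \<delta>) ^ 5 * \<delta>" by (simp add: power_mult_distrib eval_nat_numeral)
  also have "\<dots> \<le> 1 ^ 5 * \<delta>"
    using T \<delta> by (intro mult_right_mono power_mono) (auto simp: field_simps)
  finally show ?thesis unfolding e by simp
qed

text \<open>One event serves both estimates. The range of \<open>\<delta>\<close> is what places
  \<open>r\<close> between 0 and \<open>1 / 2\<close>.\<close>

lemma SCDL_sample_bounds:
  fixes D :: "(real \<times> bool) measure" and T :: nat and \<delta> :: real
  assumes D: "prob_space D" "sets D = sets borel" "measure D ({0..1} \<times> UNIV) = 1"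
    and T: "2 \<le> T" and \<delta>: "exp (- real T / 2) < \<delta>" "\<delta> < 1 / real T"
  obtains A where "A \<in> sets (PiM {..<T} (\<lambda>_. D))" "1 - \<delta> \<le> measure (PiM {..<T} (\<lambda>_. D)) A"
    "\<And>\<omega>. \<omega> \<in> A \<Longrightarrow> \<bar>SCDL (empirical \<omega> T) - SCDL D\<bar>
        \<le> 1056 * sqrt (ln (1 / \<delta>) / real T) * ln (real T / ln (1 / \<delta>))"
    "\<And>\<omega>. \<omega> \<in> A \<Longrightarrow> SCDL D = 0 \<Longrightarrow> SCDL (empirical \<omega> T)
        \<le> 1056 * sqrt (ln (1 / \<delta>) / real T * ln (real T / ln (1 / \<delta>)))"
proof -
  interpret forecast D using D by (rule forecast_borel)
  define r where "r = ln (1 / \<delta>) / real T"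
  have \<delta>0: "0 < \<delta>" using \<delta>(1) by (rule less_trans[OF exp_gt_zero])
  have "ln (1 / \<delta>) < real T / 2"
  proof -
    have "ln (exp (- real T / 2)) < ln \<delta>" using \<delta>(1) \<delta>0 by (subst ln_less_cancel_iff) auto
    then show ?thesis using \<delta>0 by (simp add: ln_div)
  qed
  moreover have lb: "1 / 2 \<le> ln (1 / \<delta>)"
  proof -
    have "1 / real T \<le> 1 / 2" using T by simp
    then show ?thesis using ln_inverse_ge[OF \<delta>0] \<delta>(2) by linarith
  qed
  ultimately have r: "0 < r" "r < 1 / 2" using T by (auto simp: r_def field_simps)
  have inv_r: "1 / r = real T / ln (1 / \<delta>)" by (simp add: r_def)
  \<comment> \<open>The perturbation lemmas only inspect scales up to \<open>1 / sqrt r\<close>,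
    which the good event covers.\<close>
  have scale: "m \<le> T" if "real m \<le> 1 / sqrt r" for m
  proof -
    have "1 / r \<le> (real T)\<^sup>2"
    proof -
      have "1 / r \<le> real T / (1 / 2)" unfolding inv_r using lb by (intro divide_left_mono) auto
      also have "\<dots> \<le> (real T)\<^sup>2" using T by (simp add: power2_eq_square)
      finally show ?thesis .
    qed
    then have "sqrt (1 / r) \<le> real T" using r by (intro real_le_lsqrt) auto
    then have "1 / sqrt r \<le> real T" by (simp add: real_sqrt_divide)
    then show ?thesis using that by linarith
  qed
  have "0 < T" "0 < 6 * r" using T r by auto
  then obtain A where A: "A \<in> sets (PiM {..<T} (\<lambda>_. D))"
    "1 - real (4 * T * (T + 1)) * exp (- real T * (6 * r)) \<le> measure (PiM {..<T} (\<lambda>_. D)) A"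
    "\<And>\<omega>. \<omega> \<in> A \<Longrightarrow> forecast (empirical \<omega> T)"
    "\<And>\<omega> m. \<omega> \<in> A \<Longrightarrow> 1 \<le> m \<Longrightarrow> m \<le> T \<Longrightarrow>
        close (6 * r) D (empirical \<omega> T) m \<and> close (6 * r) (empirical \<omega> T) D m"
    using good_sample[of T "6 * r"] by blast
  show ?thesis
  proof (rule that[OF A(1)])
    show "1 - \<delta> \<le> measure (PiM {..<T} (\<lambda>_. D)) A"
      using A(2) union_bound_le[OF T \<delta>0 \<delta>(2)] unfolding r_def by linarith
    fix \<omega> assume \<omega>: "\<omega> \<in> A"
    have N: "forecast (empirical \<omega> T)" using A(3) \<omega> .
    have "SCDL (empirical \<omega> T) \<le> SCDL D + 1056 * sqrt r * ln (1 / r)"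
      by (rule SCDL_perturb[OF forecast_axioms N r]) (use A(4) \<omega> scale in auto)
    moreover have "SCDL D \<le> SCDL (empirical \<omega> T) + 1056 * sqrt r * ln (1 / r)"
      by (rule SCDL_perturb[OF N forecast_axioms r]) (use A(4) \<omega> scale in auto)
    ultimately show "\<bar>SCDL (empirical \<omega> T) - SCDL D\<bar>
        \<le> 1056 * sqrt (ln (1 / \<delta>) / real T) * ln (real T / ln (1 / \<delta>))"
      unfolding r_def[symmetric] inv_r[symmetric] by (simp add: abs_le_iff)
    assume "SCDL D = 0"
    have "SCDL (empirical \<omega> T) \<le> 1056 * sqrt (r * ln (1 / r))"
      by (rule SCDL_perturb_zero[OF forecast_axioms N r \<open>SCDL D = 0\<close>]) (use A(4) \<omega> scale in auto)
    then show "SCDL (empirical \<omega> T)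
        \<le> 1056 * sqrt (ln (1 / \<delta>) / real T * ln (real T / ln (1 / \<delta>)))"
      unfolding r_def[symmetric] inv_r[symmetric] .
  qed
qed

theorem theorem7p1:
  "\<exists>C::real. C > 0 \<and>
    (\<forall>(D::(real \<times> bool) measure) (T::nat) (\<delta>::real).
       prob_space D \<longrightarrow> sets D = sets borel \<longrightarrow> measure D ({0..1} \<times> UNIV) = 1 \<longrightarrow>
       T \<ge> 2 \<longrightarrow> exp (- real T / 2) < \<delta> \<longrightarrow> \<delta> < 1 / real T \<longrightarrow>
       (\<exists>A \<in> sets (PiM {..<T} (\<lambda>_. D)).
          measure (PiM {..<T} (\<lambda>_. D)) A \<ge> 1 - \<delta> \<and>
          (\<forall>\<omega>\<in>A. \<bar>SCDL (empirical \<omega> T) - SCDL D\<bar>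
                   \<le> C * sqrt (ln (1 / \<delta>) / real T) * ln (real T / ln (1 / \<delta>)))) \<and>
       (SCDL D = 0 \<longrightarrow>
       (\<exists>A \<in> sets (PiM {..<T} (\<lambda>_. D)).
          measure (PiM {..<T} (\<lambda>_. D)) A \<ge> 1 - \<delta> \<and>
          (\<forall>\<omega>\<in>A. SCDL (empirical \<omega> T)
                   \<le> C * sqrt (ln (1 / \<delta>) / real T * ln (real T / ln (1 / \<delta>)))))))"
proof (intro exI[of _ 1056] conjI allI impI)
  fix D :: "(real \<times> bool) measure" and T :: nat and \<delta> :: real
  assume "prob_space D" "sets D = sets borel" "measure D ({0..1} \<times> UNIV) = 1"
    "2 \<le> T" "exp (- real T / 2) < \<delta>" "\<delta> < 1 / real T"
  note bounds = SCDL_sample_bounds[OF this]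
  show "\<exists>A \<in> sets (PiM {..<T} (\<lambda>_. D)). measure (PiM {..<T} (\<lambda>_. D)) A \<ge> 1 - \<delta> \<and>
      (\<forall>\<omega>\<in>A. \<bar>SCDL (empirical \<omega> T) - SCDL D\<bar>
        \<le> 1056 * sqrt (ln (1 / \<delta>) / real T) * ln (real T / ln (1 / \<delta>)))"
    by (rule bounds) blast
  assume "SCDL D = 0"
  show "\<exists>A \<in> sets (PiM {..<T} (\<lambda>_. D)). measure (PiM {..<T} (\<lambda>_. D)) A \<ge> 1 - \<delta> \<and>
      (\<forall>\<omega>\<in>A. SCDL (empirical \<omega> T)
        \<le> 1056 * sqrt (ln (1 / \<delta>) / real T * ln (real T / ln (1 / \<delta>))))"
    by (rule bounds) (use \<open>SCDL D = 0\<close> in blast)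
qed simp

end
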